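(* Let $I=(F_1,\dots,F_{n-1},F_n)\subset R=k[x_1,\dots,x_n]$ be a complete intersection. Suppose that $d_i=\deg F_i$ for $1\le i\le n$ and $2\le d_1\le\dots\le d_n$. Assume that one of the following holds: (a) $d_1+\dots+d_{n-1}+d_n-n$ is even and $d_n>d_1+\dots+d_{n-1}-n$; (b) $d_1+\dots+d_{n-1}+d_n-n$ is odd and $d_n>d_1+\dots+d_{n-1}-n+1$. Then $R/I$ has the Weak Lefschetz property.
   Context: $k$ is an infinite field and $R$ is standard graded; $F_1,\dots,F_n$ are homogeneous and form a regular sequence, so $R/I$ is Artinian. A standard graded Artinian $k$-algebra $A=\bigoplus A_i$ has the Weak Lefschetz property if for a general linear form $L$ the multiplication map $\times L:A_i\to A_{i+1}$ has maximal rank (is injective or surjective) for every $i$. *)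

theory Defs
  imports "HOL-Algebra.QuotRing" "HOL-Library.Cardinality" "HOL-Library.Poly_Mapping"
begin

text \<open>
  A polynomial in the variables \<open>x\<^sub>i\<close>, \<open>i :: 'n\<close>, is a finitely supported map from exponent
  vectors to coefficients, so the polynomial ring in \<open>n = CARD('n)\<close> variables over \<open>'k\<close> is the
  whole type.
\<close>

type_synonym ('n, 'k) polyn = "('n \<Rightarrow>\<^sub>0 nat) \<Rightarrow>\<^sub>0 'k"

definition polyn_ring :: "('n, 'k::field) polyn ring" where
  "polyn_ring = \<lparr>carrier = UNIV, monoid.mult = (*), one = 1, ring.zero = 0, add = (+)\<rparr>"

definition monom_degree :: "('n::finite \<Rightarrow>\<^sub>0 nat) \<Rightarrow> nat" where
  "monom_degree m = (\<Sum>i\<in>UNIV. Poly_Mapping.lookup m i)"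

text \<open>The zero polynomial is homogeneous of every degree.\<close>

definition homogeneous :: "nat \<Rightarrow> ('n::finite, 'k::field) polyn \<Rightarrow> bool" where
  "homogeneous d f \<longleftrightarrow> (\<forall>m\<in>Poly_Mapping.keys f. monom_degree m = d)"

definition linear_form :: "('n::finite \<Rightarrow> 'k::field) \<Rightarrow> ('n, 'k) polyn" where
  "linear_form c = (\<Sum>i\<in>UNIV. Poly_Mapping.single (Poly_Mapping.single i 1) (c i))"

definition polyn_eval :: "('n::finite, 'k::field) polyn \<Rightarrow> ('n \<Rightarrow> 'k) \<Rightarrow> 'k" where
  "polyn_eval f c = (\<Sum>m\<in>Poly_Mapping.keys f. Poly_Mapping.lookup f m * (\<Prod>i\<in>UNIV. c i ^ Poly_Mapping.lookup m i))"

text \<open>Zariski open subsets of affine space: complements of common zero sets.\<close>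

definition zariski_open :: "('n::finite \<Rightarrow> 'k::field) set \<Rightarrow> bool" where
  "zariski_open U \<longleftrightarrow>
     (\<exists>S :: ('n, 'k) polyn set. U = - {c. \<forall>f\<in>S. polyn_eval f c = 0})"

text \<open>
  A property holds for a general linear form if it holds on a nonempty Zariski open subset of the
  space of linear forms, identified with affine space through the coefficients.
\<close>

definition for_general_linear_form :: "(('n::finite, 'k::field) polyn \<Rightarrow> bool) \<Rightarrow> bool" where
  "for_general_linear_form P \<longleftrightarrow>
     (\<exists>U. zariski_open U \<and> U \<noteq> {} \<and> (\<forall>c\<in>U. P (linear_form c)))"

definition nonzerodivisor :: "('a, 'b) ring_scheme \<Rightarrow> 'a \<Rightarrow> bool" where
  "nonzerodivisor A a \<longleftrightarrow>
     (\<forall>b\<in>carrier A. a \<otimes>\<^bsub>A\<^esub> b = \<zero>\<^bsub>A\<^esub> \<longrightarrow> b = \<zero>\<^bsub>A\<^esub>)"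

definition regular_sequence :: "('a, 'b) ring_scheme \<Rightarrow> nat \<Rightarrow> (nat \<Rightarrow> 'a) \<Rightarrow> bool" where
  "regular_sequence R r F \<longleftrightarrow>
     (\<forall>i\<in>{1..r}. F i \<in> carrier R) \<and>
     (\<forall>i\<in>{1..r}. let J = Idl\<^bsub>R\<^esub> (F ` {1..<i})
        in nonzerodivisor (R Quot J) (J +>\<^bsub>R\<^esub> F i)) \<and>
     Idl\<^bsub>R\<^esub> (F ` {1..r}) \<noteq> carrier R"

text \<open>
  The graded pieces of \<open>R/I\<close>, for a homogeneous ideal \<open>I\<close>, are the images of those of \<open>R\<close>.
\<close>

definition graded_piece ::
    "('n::finite, 'k::field) polyn set \<Rightarrow> nat \<Rightarrow> ('n, 'k) polyn set set" where
  "graded_piece I i = (\<lambda>f. I +>\<^bsub>polyn_ring\<^esub> f) ` {f. homogeneous i f}"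

definition weak_Lefschetz :: "('n::finite, 'k::field) polyn set \<Rightarrow> bool" where
  "weak_Lefschetz I \<longleftrightarrow>
     for_general_linear_form (\<lambda>L. \<forall>i.
       let mul_L = (\<lambda>a. (I +>\<^bsub>polyn_ring\<^esub> L) \<otimes>\<^bsub>polyn_ring Quot I\<^esub> a)
       in inj_on mul_L (graded_piece I i) \<or>
          mul_L ` graded_piece I i = graded_piece I (Suc i))"

end

theory Submission
  imports Defs "Jordan_Normal_Form.Determinant"
    "HOL-Computational_Algebra.Formal_Power_Series"
begin

text \<open>
  Let \<open>J\<close> be the ideal of the first \<open>n - 1\<close> forms and \<open>m = d\<^sub>n - 1\<close>. The algebra \<open>R / J\<close> is
  one-dimensional, and its Hilbert function is constant from degree \<open>\<Sum>i<n. (d\<^sub>i - 1)\<close> on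
  (\<open>hilbert_function_eventually_constant\<close>). Both degree conditions, the first one with the help of
  parity, say that \<open>m\<close> is at least this degree. Hence \<open>R / J\<close> has the same dimension in degrees \<open>m\<close>
  and \<open>m + 1\<close>.

  Since \<open>F\<^sub>n\<close> is a form of positive degree that is regular on \<open>R / J\<close>, no nonzero class of \<open>R / J\<close> is killed by
  all the variables (\<open>ideal_saturated_if_nonzerodivisor\<close>). McCoy's theorem on zero divisors in
  polynomial rings then shows that the linear form \<open>\<Sum>i<n. s ^ i * x\<^sub>i\<close> with an indeterminate \<open>s\<close> is regular
  on \<open>(R / J)[s]\<close>, and a determinant turns this into a nonempty Zariski open set of linear forms \<open>L\<close> that multiply the
  degree \<open>m\<close> part of \<open>R / J\<close> injectively into the degree \<open>m + 1\<close> part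
  (\<open>general_linear_form_injective\<close>). By equality of dimensions the multiplication is bijective there.

  Injectivity in degree \<open>m\<close> passes to all lower degrees, because no nonzero class is killed by all the
  variables, and surjectivity passes to all higher degrees, because the algebra is generated in degree one.
  Finally \<open>R / I\<close> is a quotient of \<open>R / J\<close>, so it inherits surjectivity from degree \<open>m\<close> on, and it
  agrees with \<open>R / J\<close> up to degree \<open>m\<close>, so multiplication from degree \<open>i\<close> to \<open>i + 1\<close> is injective for
  \<open>i < m\<close>.
\<close>

section \<open>Finite-dimensional quotients of subspaces\<close>

text \<open>
  Quotients \<open>V / U\<close> of subspaces of an infinite-dimensional space are handled through
  families of representatives, so that no quotient type has to be formed.
\<close>

locale vector_space_quotient = vector_space scale
  for scale :: "'a::field \<Rightarrow> 'b::ab_group_add \<Rightarrow> 'b" (infixr \<open>*s\<close> 75)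
begin

text \<open>
  The classes of \<open>r 0, \<dots>, r (p - 1)\<close> form a basis of \<open>V / U\<close>.
\<close>

definition quotient_basis :: "'b set \<Rightarrow> 'b set \<Rightarrow> nat \<Rightarrow> (nat \<Rightarrow> 'b) \<Rightarrow> bool" where
  "quotient_basis V U p r \<longleftrightarrow>
     (\<forall>i<p. r i \<in> V) \<and>
     (\<forall>v\<in>V. \<exists>a. v - (\<Sum>i<p. a i *s r i) \<in> U) \<and>
     (\<forall>a. (\<Sum>i<p. a i *s r i) \<in> U \<longrightarrow> (\<forall>i<p. a i = 0))"

lemma dim_zero_subspace: "dim {0} = 0"
  using dim_span[of "{}"] dim_eq_card_independent[OF independent_empty] by simp

lemma in_span_imageE:
  fixes r :: "nat \<Rightarrow> 'b"
  assumes "x \<in> span (r ` {..<q})"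
  obtains a where "x = (\<Sum>i<q. a i *s r i)"
  using assms
proof (induction q arbitrary: x thesis)
  case 0
  then show ?case by simp
next
  case (Suc q)
  from Suc.prems(2) obtain k where k: "x - k *s r q \<in> span (r ` {..<q})"
    by (auto simp: lessThan_Suc span_breakdown_eq)
  obtain a where a: "x - k *s r q = (\<Sum>i<q. a i *s r i)"
    using Suc.IH[OF _ k] by blast
  have "(\<Sum>i<q. a i *s r i) = (\<Sum>i<q. (a(q := k)) i *s r i)"
    by (rule sum.cong) auto
  moreover have "x = (\<Sum>i<q. a i *s r i) + k *s r q"
    using a by (metis diff_eq_eq)
  ultimately have "x = (\<Sum>i<Suc q. (a(q := k)) i *s r i)" by simp
  then show ?case by (rule Suc.prems(1))
qed

lemma quotient_basis_exists:
  assumes U: "subspace U" and UV: "U \<subseteq> V" and S: "finite S" "V \<subseteq> span S"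
  obtains p r where "quotient_basis V U p r"
proof -
  obtain B where B: "B \<subseteq> U" "independent B" "U \<subseteq> span B"
    using basis_exists[of U] by metis
  obtain C where C: "B \<subseteq> C" "C \<subseteq> V" "independent C" "V \<subseteq> span C"
    using maximal_independent_subset_extend[of B V] B UV by (metis subset_trans)
  have finC: "finite C"
    using independent_span_bound[of S C] S C by auto
  then have finB: "finite B" using C(1) finite_subset by blast
  define p where "p = card (C - B)"
  obtain r where r: "bij_betw r {..<p} (C - B)"
    using ex_bij_betw_nat_finite[of "C - B"] finC unfolding p_def atLeast0LessThan by blast
  have rim: "r ` {..<p} = C - B" using r by (rule bij_betw_imp_surj_on)
  have spB: "span B \<subseteq> U" using span_minimal[OF B(1) U] .
  have "quotient_basis V U p r"
    unfolding quotient_basis_def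
  proof (intro conjI allI impI ballI)
    fix i assume "i < p"
    then show "r i \<in> V" using rim C(2) by auto
  next
    fix v assume "v \<in> V"
    then have "v \<in> span (B \<union> r ` {..<p})" using C(1,4) rim by (auto simp: Un_absorb1)
    then obtain x y where xy: "v = x + y" "x \<in> span B" "y \<in> span (r ` {..<p})"
      unfolding span_Un by blast
    obtain a where "y = (\<Sum>i<p. a i *s r i)" using in_span_imageE[OF xy(3)] .
    then show "\<exists>a. v - (\<Sum>i<p. a i *s r i) \<in> U"
      using xy spB by (intro exI[of _ a]) auto
  next
    fix a i assume aU: "(\<Sum>i<p. a i *s r i) \<in> U" and i: "i < p"
    then have "(\<Sum>i<p. a i *s r i) \<in> span B" using B(3) by auto
    then obtain u where u: "(\<Sum>i<p. a i *s r i) = (\<Sum>b\<in>B. u b *s b)"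
      unfolding span_finite[OF finB] by auto
    define w where "w c = (if c \<in> B then u c else - a (the_inv_into {..<p} r c))" for c
    have inv: "the_inv_into {..<p} r (r j) = j" if "j < p" for j
      using that r by (simp add: bij_betw_def the_inv_into_f_f)
    have rnB: "r j \<notin> B" if "j < p" for j using rim that by auto
    have "(\<Sum>c\<in>C. w c *s c) = (\<Sum>c\<in>C - B. w c *s c) + (\<Sum>c\<in>B. w c *s c)"
      using sum.subset_diff[OF C(1) finC] .
    also have "(\<Sum>c\<in>B. w c *s c) = (\<Sum>i<p. a i *s r i)"
      unfolding u by (simp add: w_def)
    also have "(\<Sum>c\<in>C - B. w c *s c) = (\<Sum>j<p. w (r j) *s r j)"
      using sum.reindex_bij_betw[OF r, of "\<lambda>c. w c *s c"] by simp
    also have "\<dots> = - (\<Sum>j<p. a j *s r j)"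
      unfolding sum_negf[symmetric] by (rule sum.cong) (auto simp: w_def inv rnB)
    finally have "(\<Sum>c\<in>C. w c *s c) = 0" by simp
    moreover have "r i \<in> C" using rim i by auto
    ultimately have "w (r i) = 0" using independentD[OF C(3) finC] by blast
    then show "a i = 0" using i by (simp add: w_def inv rnB)
  qed
  then show thesis by (rule that)
qed

lemma dim_quotient_basis:
  assumes U: "subspace U" and V: "subspace V" and UV: "U \<subseteq> V"
    and S: "finite S" "V \<subseteq> span S" and qb: "quotient_basis V U p r"
  shows "dim V = dim U + p"
proof -
  obtain B where B: "B \<subseteq> U" "independent B" "U \<subseteq> span B" "card B = dim U"
    using basis_exists[of U] by metis
  have finB: "finite B" using independent_span_bound[of S B] S B UV by auto
  have spB: "span B \<subseteq> U" using span_minimal[OF B(1) U] .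
  have rV: "r i \<in> V" if "i < p" for i using qb that by (simp add: quotient_basis_def)
  have ind: "independent (B \<union> r ` {..<q}) \<and> card (B \<union> r ` {..<q}) = card B + q" if "q \<le> p" for q
    using that
  proof (induction q)
    case 0
    then show ?case using B by simp
  next
    case (Suc q)
    have nin: "r q \<notin> span (B \<union> r ` {..<q})"
    proof
      assume "r q \<in> span (B \<union> r ` {..<q})"
      then obtain x y where xy: "r q = x + y" "x \<in> span B" "y \<in> span (r ` {..<q})"
        unfolding span_Un by blast
      obtain a where a: "y = (\<Sum>i<q. a i *s r i)" using in_span_imageE[OF xy(3)] .
      define b where "b i = (if i < q then - a i else if i = q then 1 else 0)" for i
      have "(\<Sum>i<p. b i *s r i) = (\<Sum>i<Suc q. b i *s r i)"
        using Suc.prems by (intro sum.mono_neutral_right) (auto simp: b_def)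
      also have "\<dots> = (\<Sum>i<q. - (a i *s r i)) + r q"
      proof -
        have "(\<Sum>i<q. b i *s r i) = (\<Sum>i<q. - (a i *s r i))"
          by (rule sum.cong) (auto simp: b_def)
        moreover have "b q = 1" by (simp add: b_def)
        ultimately show ?thesis by (simp only: sum.lessThan_Suc scale_one)
      qed
      also have "\<dots> = x"
        unfolding sum_negf a[symmetric] xy(1) by simp
      finally have "(\<Sum>i<p. b i *s r i) \<in> U" using xy(2) spB by auto
      then have "b q = 0" using qb Suc.prems by (auto simp: quotient_basis_def)
      then show False by (simp add: b_def)
    qed
    have eq: "B \<union> r ` {..<Suc q} = insert (r q) (B \<union> r ` {..<q})"
      by (auto simp: lessThan_Suc)
    have "r q \<notin> B \<union> r ` {..<q}" 
      using nin by (rule contrapos_nn) (rule span_base)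
    then show ?case
      using Suc.IH Suc.prems finB independent_insertI[OF nin] unfolding eq by simp
  qed
  have "dim V = card (B \<union> r ` {..<p})"
  proof (rule basis_card_eq_dim[symmetric])
    show "B \<union> r ` {..<p} \<subseteq> V" using B(1) UV rV by auto
    show "V \<subseteq> span (B \<union> r ` {..<p})"
    proof
      fix v assume "v \<in> V"
      then obtain a where a: "v - (\<Sum>i<p. a i *s r i) \<in> U"
        using qb by (auto simp: quotient_basis_def)
      have "v - (\<Sum>i<p. a i *s r i) \<in> span (B \<union> r ` {..<p})"
        using a B(3) span_mono[of B "B \<union> r ` {..<p}"] by auto
      moreover have "(\<Sum>i<p. a i *s r i) \<in> span (B \<union> r ` {..<p})"
        by (intro span_sum span_scale span_base) auto
      ultimately show "v \<in> span (B \<union> r ` {..<p})"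
        using span_add by fastforce
    qed
    show "independent (B \<union> r ` {..<p})" using ind by blast
  qed
  then show ?thesis using ind[of p] B(4) by simp
qed

lemma subspace_eq_if_dim_eq:
  assumes "subspace U" "subspace V" "U \<subseteq> V" "finite S" "V \<subseteq> span S" "dim U = dim V"
  shows "U = V"
proof -
  obtain p r where qb: "quotient_basis V U p r"
    using quotient_basis_exists[OF assms(1,3,4,5)] .
  then have "p = 0" using dim_quotient_basis[OF assms(1-5) qb] assms(6) by simp
  then show ?thesis using qb assms(3) by (auto simp: quotient_basis_def)
qed

lemma quotient_basis_image:
  assumes f: "module_hom scale scale f" and V: "subspace V" and U': "subspace U'"
    and iff: "\<And>v. v \<in> V \<Longrightarrow> f v \<in> U' \<longleftrightarrow> v \<in> U"
    and qb: "quotient_basis V U p r"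
  shows "quotient_basis {x + f v | x v. x \<in> U' \<and> v \<in> V} U' p (f \<circ> r)"
proof -
  interpret f: module_hom scale scale f by (rule f)
  have rV: "r i \<in> V" if "i < p" for i using qb that by (simp add: quotient_basis_def)
  have comb: "(\<Sum>i<p. a i *s r i) \<in> V" for a
    by (intro subspace_sum[OF V] subspace_scale[OF V] rV) auto
  have fcomb: "(\<Sum>i<p. a i *s (f \<circ> r) i) = f (\<Sum>i<p. a i *s r i)" for a
    by (simp add: f.sum f.scale)
  show ?thesis
    unfolding quotient_basis_def fcomb
  proof (intro conjI allI impI ballI)
    fix i assume "i < p"
    then show "(f \<circ> r) i \<in> {x + f v | x v. x \<in> U' \<and> v \<in> V}"
      using rV[of i] subspace_0[OF U'] by (intro CollectI exI[of _ 0] exI[of _ "r i"]) simp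
  next
    fix w assume "w \<in> {x + f v | x v. x \<in> U' \<and> v \<in> V}"
    then obtain x v where w: "w = x + f v" "x \<in> U'" "v \<in> V" by blast
    obtain a where a: "v - (\<Sum>i<p. a i *s r i) \<in> U"
      using qb w by (auto simp: quotient_basis_def)
    have "f (v - (\<Sum>i<p. a i *s r i)) \<in> U'"
      using iff subspace_diff[OF V w(3) comb] a by blast
    then have "x + (f v - f (\<Sum>i<p. a i *s r i)) \<in> U'"
      unfolding f.diff by (rule subspace_add[OF U' w(2)])
    then show "\<exists>a. w - f (\<Sum>i<p. a i *s r i) \<in> U'"
      unfolding w(1) add_diff_eq by blast
  next
    fix a i assume "f (\<Sum>i<p. a i *s r i) \<in> U'" "i < p"
    then show "a i = 0" using iff[OF comb] qb by (auto simp: quotient_basis_def)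
  qed
qed

text \<open>
  The hypothesis on preimages says that \<open>f\<close> induces an injection \<open>V / U \<rightarrow> (U' + f V) / U'\<close>, which is
  onto by definition, so both quotients have the same dimension. The case of
  interest is multiplication by a form that is regular modulo an ideal.
\<close>

lemma dim_image_mod_subspace:
  assumes f: "module_hom scale scale f" and V: "subspace V" and U: "subspace U"
    and U': "subspace U'" and UV: "U \<subseteq> V"
    and iff: "\<And>v. v \<in> V \<Longrightarrow> f v \<in> U' \<longleftrightarrow> v \<in> U"
    and S: "finite S" "V \<subseteq> span S" and S': "finite S'" "U' \<subseteq> span S'"
  shows "dim {x + f v | x v. x \<in> U' \<and> v \<in> V} + dim U = dim U' + dim V"
proof -
  interpret f: module_hom scale scale f by (rule f)
  obtain p r where qb: "quotient_basis V U p r"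
    using quotient_basis_exists[OF U UV S] .
  let ?W = "{x + f v | x v. x \<in> U' \<and> v \<in> V}"
  have "{x + y | x y. x \<in> U' \<and> y \<in> f ` V} = ?W" by auto
  then have W: "subspace ?W"
    using subspace_sums[OF U' f.subspace_image[OF V]] by simp
  have "?W \<subseteq> span (S' \<union> f ` S)"
    unfolding span_Un f.span_image using S(2) S'(2) by blast
  moreover have "U' \<subseteq> ?W"
  proof
    fix x assume "x \<in> U'"
    then show "x \<in> ?W"
      using subspace_0[OF V] by (intro CollectI exI[of _ x] exI[of _ 0]) simp
  qed
  moreover have "finite (S' \<union> f ` S)" using S(1) S'(1) by simp
  moreover have "quotient_basis ?W U' p (f \<circ> r)"
    by (rule quotient_basis_image[OF f V U' iff qb])
  ultimately have "dim ?W = dim U' + p"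
    by (intro dim_quotient_basis[OF U' W])
  with dim_quotient_basis[OF U V UV S qb] show ?thesis by simp
qed

end

section \<open>The polynomial ring as a graded vector space\<close>

lemma polyn_eq_sum_single:
  "p = (\<Sum>m\<in>Poly_Mapping.keys p. Poly_Mapping.single m (Poly_Mapping.lookup p m))"
proof (rule poly_mapping_eqI)
  fix k
  have "(\<Sum>m\<in>Poly_Mapping.keys p. Poly_Mapping.lookup p m when m = k) = Poly_Mapping.lookup p k"
  proof (cases "k \<in> Poly_Mapping.keys p")
    case True
    then show ?thesis by (subst sum.remove[of _ k]) (auto intro!: sum.neutral)
  next
    case False
    then show ?thesis by (auto intro!: sum.neutral simp: in_keys_iff when_def)
  qed
  then show "Poly_Mapping.lookup p k = Poly_Mapping.lookup
      (\<Sum>m\<in>Poly_Mapping.keys p. Poly_Mapping.single m (Poly_Mapping.lookup p m)) k"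
    by (simp add: lookup_sum lookup_single)
qed

lemma polyn_induct [case_names zero single add]:
  assumes "P 0" "\<And>m c. P (Poly_Mapping.single m c)" "\<And>f g. P f \<Longrightarrow> P g \<Longrightarrow> P (f + g)"
  shows "P (p :: 'a \<Rightarrow>\<^sub>0 'b::comm_monoid_add)"
proof -
  have "P (\<Sum>m\<in>A. Poly_Mapping.single m (Poly_Mapping.lookup p m))" if "finite A" for A
    using that by induction (auto intro: assms)
  then show ?thesis by (subst polyn_eq_sum_single) simp
qed

definition pscale :: "'k \<Rightarrow> ('n, 'k::field) polyn \<Rightarrow> ('n, 'k) polyn" where
  "pscale c p = Poly_Mapping.single 0 c * p"

lemma lookup_pscale: "Poly_Mapping.lookup (pscale c p) m = c * Poly_Mapping.lookup p m"
  unfolding pscale_def mult_map_scale_conv_mult[symmetric] by (simp add: map.rep_eq when_def)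

interpretation polyn: vector_space_quotient pscale
  by unfold_locales
    (simp_all add: pscale_def algebra_simps single_add mult_single flip: mult.assoc)

lemma pscale_mult_right: "f * pscale c g = pscale c (f * g)"
  by (simp add: pscale_def ac_simps)

lemma module_hom_times: "module_hom pscale pscale (\<lambda>g. f * g)"
  by unfold_locales (simp_all add: distrib_left pscale_mult_right)

lemma monom_degree_add: "monom_degree (a + b) = monom_degree a + monom_degree b"
  by (simp add: monom_degree_def lookup_add sum.distrib)

lemma monom_degree_single: "monom_degree (Poly_Mapping.single i c) = c"
  by (simp add: monom_degree_def lookup_single when_def)

lemma homogeneous_altdef:
  "homogeneous i f \<longleftrightarrow> (\<forall>m. monom_degree m \<noteq> i \<longrightarrow> Poly_Mapping.lookup f m = 0)"
  unfolding homogeneous_def by (metis in_keys_iff)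

lemma homogeneous_single: "homogeneous (monom_degree m) (Poly_Mapping.single m c)"
  by (auto simp: homogeneous_def)

lemma homogeneous_mult:
  assumes "homogeneous a f" "homogeneous b g"
  shows "homogeneous (a + b) (f * g)"
  unfolding homogeneous_def
proof
  fix m assume "m \<in> Poly_Mapping.keys (f * g)"
  then obtain k l where "m = k + l" "k \<in> Poly_Mapping.keys f" "l \<in> Poly_Mapping.keys g"
    using keys_mult[of f g] by blast
  then show "monom_degree m = a + b"
    using assms by (simp add: homogeneous_def monom_degree_add)
qed

lemma homogeneous_0: "homogeneous i 0"
  by (simp add: homogeneous_def)

lemma subspace_homogeneous: "polyn.subspace {f. homogeneous i f}"
  by (rule polyn.subspaceI) (auto simp: homogeneous_altdef lookup_add lookup_pscale)

lemma homogeneous_add: "homogeneous i f \<Longrightarrow> homogeneous i g \<Longrightarrow> homogeneous i (f + g)"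
  using polyn.subspace_add[OF subspace_homogeneous[of i], of f g] by simp

lemma homogeneous_diff: "homogeneous i f \<Longrightarrow> homogeneous i g \<Longrightarrow> homogeneous i (f - g)"
  using polyn.subspace_diff[OF subspace_homogeneous[of i], of f g] by simp

lemma homogeneous_sum: "(\<And>x. x \<in> A \<Longrightarrow> homogeneous i (f x)) \<Longrightarrow> homogeneous i (sum f A)"
  using polyn.subspace_sum[OF subspace_homogeneous[of i], of A f] by simp

lemma homogeneous_pscale: "homogeneous i f \<Longrightarrow> homogeneous i (pscale c f)"
  using polyn.subspace_scale[OF subspace_homogeneous[of i], of f c] by simp

definition homogeneous_component :: "nat \<Rightarrow> ('n::finite, 'k::field) polyn \<Rightarrow> ('n, 'k) polyn" where
  "homogeneous_component i f = (\<Sum>m\<in>Poly_Mapping.keys f.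
     if monom_degree m = i then Poly_Mapping.single m (Poly_Mapping.lookup f m) else 0)"

lemma lookup_homogeneous_component:
  "Poly_Mapping.lookup (homogeneous_component i f) m = (if monom_degree m = i then Poly_Mapping.lookup f m else 0)"
proof -
  have "Poly_Mapping.lookup (homogeneous_component i f) m =
      (\<Sum>k\<in>Poly_Mapping.keys f. if k = m then (if monom_degree m = i then Poly_Mapping.lookup f m else 0) else 0)"
    unfolding homogeneous_component_def lookup_sum by (rule sum.cong) (auto simp: lookup_single when_def)
  then show ?thesis by (simp add: in_keys_iff)
qed

lemma homogeneous_component_0 [simp]: "homogeneous_component i 0 = 0"
  by (simp add: homogeneous_component_def)

lemma homogeneous_component_add: "homogeneous_component i (f + g) = homogeneous_component i f + homogeneous_component i g"
  by (rule poly_mapping_eqI) (simp add: lookup_homogeneous_component lookup_add)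

lemma homogeneous_component_homogeneous: "homogeneous j f \<Longrightarrow> homogeneous_component i f = (if i = j then f else 0)"
  by (rule poly_mapping_eqI) (auto simp: lookup_homogeneous_component homogeneous_altdef)

lemma homogeneous_homogeneous_component: "homogeneous i (homogeneous_component i f)"
  by (simp add: homogeneous_altdef lookup_homogeneous_component)

lemma homogeneous_component_mult:
  assumes "homogeneous d f"
  shows "homogeneous_component i (f * g) = (if d \<le> i then f * homogeneous_component (i - d) g else 0)"
proof (induction g rule: polyn_induct)
  case zero
  show ?case by simp
next
  case (single m c)
  show ?case
    using homogeneous_component_homogeneous[OF homogeneous_mult[OF assms homogeneous_single[of m c]], of i]
      homogeneous_component_homogeneous[OF homogeneous_single[of m c], of "i - d"]
    by auto
next
  case (add f g)
  then show ?case by (simp add: homogeneous_component_add distrib_left)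
qed

section \<open>Homogeneous ideals\<close>

lemma polyn_ring_simps [simp]:
  "carrier polyn_ring = UNIV" "x \<otimes>\<^bsub>polyn_ring\<^esub> y = x * y" "x \<oplus>\<^bsub>polyn_ring\<^esub> y = x + y"
  "\<zero>\<^bsub>polyn_ring\<^esub> = 0" "\<one>\<^bsub>polyn_ring\<^esub> = 1"
  by (simp_all add: polyn_ring_def)

lemma cring_polyn_ring: "cring polyn_ring"
proof (intro cringI abelian_groupI comm_monoidI)
  fix x :: "('n, 'k::field) polyn"
  show "\<exists>y\<in>carrier polyn_ring. y \<oplus>\<^bsub>polyn_ring\<^esub> x = \<zero>\<^bsub>polyn_ring\<^esub>"
    by (simp add: exI[of _ "- x"])
qed (simp_all add: algebra_simps)

lemma ring_polyn_ring: "ring polyn_ring"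
  using cring_polyn_ring by (rule cring.axioms)

lemma polyn_idealI:
  fixes J :: "('n, 'k::field) polyn set"
  assumes "0 \<in> J" "\<And>a b. a \<in> J \<Longrightarrow> b \<in> J \<Longrightarrow> a + b \<in> J" "\<And>a g. a \<in> J \<Longrightarrow> g * a \<in> J"
  shows "ideal J polyn_ring"
proof (rule idealI)
  interpret cring "polyn_ring :: ('n, 'k) polyn ring" by (rule cring_polyn_ring)
  show "ring (polyn_ring :: ('n, 'k) polyn ring)" by (rule ring_polyn_ring)
  show "subgroup J (add_monoid polyn_ring)"
  proof (rule subgroup.intro)
    fix x assume "x \<in> J"
    then have "- x \<in> J" using assms(3)[of x "- 1"] by simp
    moreover have "\<ominus>\<^bsub>polyn_ring\<^esub> x = - x"
      by (rule minus_equality) simp_all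
    ultimately show "inv\<^bsub>add_monoid polyn_ring\<^esub> x \<in> J" by (simp add: a_inv_def)
  qed (simp_all add: assms)
  fix a x assume a: "a \<in> J"
  show "x \<otimes>\<^bsub>polyn_ring\<^esub> a \<in> J" using assms(3)[OF a, of x] by simp
  show "a \<otimes>\<^bsub>polyn_ring\<^esub> x \<in> J" using assms(3)[OF a, of x] by (simp add: mult.commute)
qed

lemma
  fixes J :: "('n, 'k::field) polyn set"
  assumes "ideal J polyn_ring"
  shows ideal_zero: "0 \<in> J"
    and ideal_add: "a \<in> J \<Longrightarrow> b \<in> J \<Longrightarrow> a + b \<in> J"
    and ideal_mult: "a \<in> J \<Longrightarrow> g * a \<in> J"
proof -
  note sub = ideal.axioms(1)[OF assms]
  show "0 \<in> J" using additive_subgroup.zero_closed[OF sub] by simp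
  show "a \<in> J \<Longrightarrow> b \<in> J \<Longrightarrow> a + b \<in> J"
    using additive_subgroup.a_closed[OF sub, of a b] by simp
  show "a \<in> J \<Longrightarrow> g * a \<in> J" using ideal.I_l_closed[OF assms, of a g] by simp
qed

lemma subspace_ideal: "ideal J polyn_ring \<Longrightarrow> polyn.subspace J"
  by (rule polyn.subspaceI) (auto simp: pscale_def ideal_zero ideal_add ideal_mult)

lemma ideal_diff: "ideal J polyn_ring \<Longrightarrow> a \<in> J \<Longrightarrow> b \<in> J \<Longrightarrow> a - b \<in> J"
  by (rule polyn.subspace_diff[OF subspace_ideal])

lemma ideal_sum: "ideal J polyn_ring \<Longrightarrow> (\<And>x. x \<in> A \<Longrightarrow> f x \<in> J) \<Longrightarrow> sum f A \<in> J"
  by (rule polyn.subspace_sum[OF subspace_ideal])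

lemma ideal_add_cancel: "ideal J polyn_ring \<Longrightarrow> a \<in> J \<Longrightarrow> a + b \<in> J \<longleftrightarrow> b \<in> J"
  using ideal_diff[of J "a + b" a] ideal_add[of J a b] by auto

lemma ideal_Idl: "ideal (Idl\<^bsub>polyn_ring\<^esub> S) polyn_ring"
  using ring.genideal_ideal[OF ring_polyn_ring] by simp

lemma Idl_empty: "Idl\<^bsub>polyn_ring\<^esub> {} = {0}"
proof
  have "ideal {0} polyn_ring" by (rule polyn_idealI) auto
  then show "Idl\<^bsub>polyn_ring\<^esub> {} \<subseteq> {0}"
    using ring.genideal_minimal[OF ring_polyn_ring] by blast
  show "{0} \<subseteq> Idl\<^bsub>polyn_ring\<^esub> {}" using ideal_zero[OF ideal_Idl] by blast
qed

lemma Idl_insert: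
  "Idl\<^bsub>polyn_ring\<^esub> (insert f S) = {a + f * g | a g. a \<in> Idl\<^bsub>polyn_ring\<^esub> S}" (is "?L = ?R")
proof
  have I: "ideal (Idl\<^bsub>polyn_ring\<^esub> S) polyn_ring" by (rule ideal_Idl)
  have "ideal ?R polyn_ring"
  proof (rule polyn_idealI)
    show "0 \<in> ?R" using ideal_zero[OF I] by (force intro: exI[of _ 0])
  next
    fix x y assume "x \<in> ?R" "y \<in> ?R"
    then obtain a g b h where "x = a + f * g" "y = b + f * h"
      and ab: "a \<in> Idl\<^bsub>polyn_ring\<^esub> S" "b \<in> Idl\<^bsub>polyn_ring\<^esub> S" by blast
    then have "x + y = (a + b) + f * (g + h)" by (simp add: algebra_simps)
    then show "x + y \<in> ?R" using ideal_add[OF I ab] by blast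
  next
    fix x h assume "x \<in> ?R"
    then obtain a g where x: "x = a + f * g" and a: "a \<in> Idl\<^bsub>polyn_ring\<^esub> S" by blast
    have "h * x = h * a + f * (h * g)" by (simp add: x algebra_simps)
    then show "h * x \<in> ?R" using ideal_mult[OF I a] by blast
  qed
  moreover have "insert f S \<subseteq> ?R"
  proof -
    have "f = 0 + f * 1" by simp
    moreover have "s = s + f * 0" for s by simp
    moreover have "S \<subseteq> Idl\<^bsub>polyn_ring\<^esub> S"
      using ring.genideal_self[OF ring_polyn_ring] by simp
    ultimately show ?thesis using ideal_zero[OF I] by blast
  qed
  ultimately show "?L \<subseteq> ?R"
    by (rule ring.genideal_minimal[OF ring_polyn_ring])
next
  have L: "ideal ?L polyn_ring" by (rule ideal_Idl)
  have ins: "insert f S \<subseteq> ?L"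
    using ring.genideal_self[OF ring_polyn_ring, of "insert f S"] by simp
  then have "Idl\<^bsub>polyn_ring\<^esub> S \<subseteq> ?L"
    using ring.genideal_minimal[OF ring_polyn_ring L] by simp
  moreover have "f * g \<in> ?L" for g
    using ideal_mult[OF L, of f g] ins by (simp add: mult.commute)
  ultimately show "?R \<subseteq> ?L" using ideal_add[OF L] by blast
qed

definition homogeneous_ideal :: "('n::finite, 'k::field) polyn set \<Rightarrow> bool" where
  "homogeneous_ideal J \<longleftrightarrow> ideal J polyn_ring \<and> (\<forall>f\<in>J. \<forall>i. homogeneous_component i f \<in> J)"

lemma homogeneous_ideal_insert:
  assumes "homogeneous_ideal (Idl\<^bsub>polyn_ring\<^esub> S)" "homogeneous d f"
  shows "homogeneous_ideal (Idl\<^bsub>polyn_ring\<^esub> (insert f S))"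
  unfolding homogeneous_ideal_def
proof (intro conjI ballI allI)
  show "ideal (Idl\<^bsub>polyn_ring\<^esub> (insert f S)) polyn_ring" by (rule ideal_Idl)
  fix x i assume "x \<in> Idl\<^bsub>polyn_ring\<^esub> (insert f S)"
  then obtain a g where x: "x = a + f * g" and a: "a \<in> Idl\<^bsub>polyn_ring\<^esub> S"
    by (auto simp: Idl_insert)
  have "homogeneous_component i x = homogeneous_component i a + f * (if d \<le> i then homogeneous_component (i - d) g else 0)"
    unfolding x homogeneous_component_add homogeneous_component_mult[OF assms(2)] by simp
  moreover have "homogeneous_component i a \<in> Idl\<^bsub>polyn_ring\<^esub> S"
    using a assms(1) by (simp add: homogeneous_ideal_def)
  ultimately show "homogeneous_component i x \<in> Idl\<^bsub>polyn_ring\<^esub> (insert f S)"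
    unfolding Idl_insert by blast
qed

lemma homogeneous_ideal_Idl:
  assumes "finite A" "\<And>i. i \<in> A \<Longrightarrow> homogeneous (d i) (F i)"
  shows "homogeneous_ideal (Idl\<^bsub>polyn_ring\<^esub> (F ` A))"
  using assms
proof induction
  case empty
  show ?case
    using ideal_Idl[of "{}"] by (simp add: homogeneous_ideal_def Idl_empty)
next
  case (insert x A)
  then show ?case using homogeneous_ideal_insert[of "F ` A" "d x" "F x"] by simp
qed

lemma coset_eq_iff:
  fixes J :: "('n, 'k::field) polyn set"
  assumes J: "ideal J polyn_ring"
  shows "J +>\<^bsub>polyn_ring\<^esub> x = J +>\<^bsub>polyn_ring\<^esub> y \<longleftrightarrow> x - y \<in> J"
proof -
  have cs: "J +>\<^bsub>polyn_ring\<^esub> z = {w. w - z \<in> J}" for z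
    proof -
    have "w \<in> J +>\<^bsub>polyn_ring\<^esub> z \<longleftrightarrow> (\<exists>h\<in>J. w = h + z)" for w
      unfolding a_r_coset_def' by auto
    also have "(\<exists>h\<in>J. w = h + z) \<longleftrightarrow> w - z \<in> J" for w
      by (metis add_diff_cancel_right' diff_add_cancel)
    finally show ?thesis by blast
  qed
  show ?thesis
  proof
    assume "J +>\<^bsub>polyn_ring\<^esub> x = J +>\<^bsub>polyn_ring\<^esub> y"
    moreover have "x \<in> J +>\<^bsub>polyn_ring\<^esub> x" by (simp add: cs ideal_zero[OF J])
    ultimately show "x - y \<in> J" by (simp add: cs)
  next
    assume xy: "x - y \<in> J"
    have "w - x \<in> J \<longleftrightarrow> w - y \<in> J" for w
      using ideal_add_cancel[OF J xy, of "w - x"] by simp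
    then show "J +>\<^bsub>polyn_ring\<^esub> x = J +>\<^bsub>polyn_ring\<^esub> y" by (auto simp: cs)
  qed
qed

lemma coset_0: "J +>\<^bsub>polyn_ring\<^esub> 0 = J"
  by (simp add: a_r_coset_def')

lemma coset_mult:
  assumes "ideal J polyn_ring"
  shows "(J +>\<^bsub>polyn_ring\<^esub> f) \<otimes>\<^bsub>polyn_ring Quot J\<^esub> (J +>\<^bsub>polyn_ring\<^esub> g) = J +>\<^bsub>polyn_ring\<^esub> (f * g)"
  using ideal.rcoset_mult_add[OF assms, of f g] by (simp add: FactRing_def)

lemma nonzerodivisor_Quot_iff:
  assumes J: "ideal J polyn_ring"
  shows "nonzerodivisor (polyn_ring Quot J) (J +>\<^bsub>polyn_ring\<^esub> f) \<longleftrightarrow> (\<forall>g. f * g \<in> J \<longrightarrow> g \<in> J)"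
proof -
  have c: "carrier (polyn_ring Quot J) = range (\<lambda>g. J +>\<^bsub>polyn_ring\<^esub> g)"
    by (auto simp: FactRing_def A_RCOSETS_def')
  have z: "\<zero>\<^bsub>polyn_ring Quot J\<^esub> = J +>\<^bsub>polyn_ring\<^esub> 0"
    by (simp add: FactRing_def coset_0)
  show ?thesis
    unfolding nonzerodivisor_def c z by (simp add: coset_mult[OF J] coset_eq_iff[OF J])
qed

section \<open>Hilbert functions of regular sequences\<close>

text \<open>
  Exponent vectors of degree \<open>i\<close> correspond to lists of length \<open>n\<close> with sum \<open>i\<close>, which are what the
  coefficients of the \<open>n\<close>-th power of a formal power series range over.
\<close>

lemma bij_betw_monom_natpermute:
  obtains \<phi> where
    "bij_betw \<phi> {m :: 'n::finite \<Rightarrow>\<^sub>0 nat. monom_degree m = i} (natpermute i CARD('n))"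
proof -
  obtain e :: "nat \<Rightarrow> 'n" where e: "bij_betw e {..<CARD('n)} UNIV"
    using ex_bij_betw_nat_finite[of "UNIV :: 'n set"] by (auto simp: atLeast0LessThan)
  define \<phi> where "\<phi> m = map (\<lambda>j. Poly_Mapping.lookup m (e j)) [0..<CARD('n)]" for m :: "'n \<Rightarrow>\<^sub>0 nat"
  have sum: "sum_list (\<phi> m) = monom_degree m" for m
    unfolding \<phi>_def monom_degree_def
    using sum.reindex_bij_betw[OF e, of "Poly_Mapping.lookup m"]
    by (simp add: interv_sum_list_conv_sum_set_nat atLeast0LessThan)
  have surj_e: "\<exists>j<CARD('n). x = e j" for x
    using bij_betw_imp_surj_on[OF e] by auto
  have "bij_betw \<phi> {m. monom_degree m = i} (natpermute i CARD('n))"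
    unfolding bij_betw_def
  proof
    show "inj_on \<phi> {m. monom_degree m = i}"
    proof (rule inj_onI, rule poly_mapping_eqI)
      fix m m' :: "'n \<Rightarrow>\<^sub>0 nat" and x assume eq: "\<phi> m = \<phi> m'"
      obtain j where "j < CARD('n)" "x = e j" using surj_e by blast
      then show "Poly_Mapping.lookup m x = Poly_Mapping.lookup m' x"
        using arg_cong[OF eq, of "\<lambda>l. l ! j"] by (simp add: \<phi>_def)
    qed
    show "\<phi> ` {m. monom_degree m = i} = natpermute i CARD('n)"
    proof
      show "\<phi> ` {m. monom_degree m = i} \<subseteq> natpermute i CARD('n)"
        using sum by (auto simp: natpermute_def) (simp add: \<phi>_def)
      show "natpermute i CARD('n) \<subseteq> \<phi> ` {m. monom_degree m = i}"
      proof
        fix l assume l: "l \<in> natpermute i CARD('n)"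
        define m where "m = Abs_poly_mapping (\<lambda>x. l ! the_inv_into {..<CARD('n)} e x)"
        have "\<phi> m = l"
        proof (rule nth_equalityI)
          show "length (\<phi> m) = length l" using l by (simp add: \<phi>_def natpermute_def)
          fix j assume "j < length (\<phi> m)"
          then have "j < CARD('n)" by (simp add: \<phi>_def)
          then show "\<phi> m ! j = l ! j"
            using e by (simp add: \<phi>_def m_def bij_betw_def the_inv_into_f_f)
        qed
        moreover have "monom_degree m = i"
          using sum[of m] l \<open>\<phi> m = l\<close> by (simp add: natpermute_def)
        ultimately show "l \<in> \<phi> ` {m. monom_degree m = i}" by blast
      qed
    qed
  qed
  then show thesis by (rule that)
qed

lemma finite_monom_degree: "finite {m :: 'n::finite \<Rightarrow>\<^sub>0 nat. monom_degree m = i}"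
  by (rule bij_betw_monom_natpermute[where 'n = 'n and i = i])
    (simp add: bij_betw_finite natpermute_finite)

lemma card_monom_degree:
  "card {m :: 'n::finite \<Rightarrow>\<^sub>0 nat. monom_degree m = i} = card (natpermute i CARD('n))"
  by (rule bij_betw_monom_natpermute[where 'n = 'n and i = i]) (rule bij_betw_same_card)

definition monomial_basis :: "nat \<Rightarrow> ('n::finite, 'k::field) polyn set" where
  "monomial_basis i = (\<lambda>m. Poly_Mapping.single m 1) ` {m. monom_degree m = i}"

lemma finite_monomial_basis: "finite (monomial_basis i)"
  by (simp add: monomial_basis_def finite_monom_degree)

lemma homogeneous_eq_span:
  "{f :: ('n::finite, 'k::field) polyn. homogeneous i f} = polyn.span (monomial_basis i)"
proof
  show "polyn.span (monomial_basis i) \<subseteq> {f :: ('n, 'k) polyn. homogeneous i f}"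
    by (rule polyn.span_minimal) (auto simp: monomial_basis_def homogeneous_single subspace_homogeneous)
  show "{f :: ('n, 'k) polyn. homogeneous i f} \<subseteq> polyn.span (monomial_basis i)"
  proof
    fix f :: "('n, 'k) polyn" assume "f \<in> {f. homogeneous i f}"
    then have "Poly_Mapping.single m 1 \<in> (monomial_basis i :: ('n, 'k) polyn set)"
      if "m \<in> Poly_Mapping.keys f" for m
      using that by (auto simp: homogeneous_def monomial_basis_def)
    then have "(\<Sum>m\<in>Poly_Mapping.keys f. pscale (Poly_Mapping.lookup f m) (Poly_Mapping.single m 1))
        \<in> polyn.span (monomial_basis i)"
      by (intro polyn.span_sum polyn.span_scale polyn.span_base)
    also have "(\<Sum>m\<in>Poly_Mapping.keys f. pscale (Poly_Mapping.lookup f m) (Poly_Mapping.single m 1)) = f"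
      by (subst (3) polyn_eq_sum_single) (simp add: pscale_def mult_single)
    finally show "f \<in> polyn.span (monomial_basis i)" .
  qed
qed

lemma dim_homogeneous:
  "polyn.dim {f :: ('n::finite, 'k::field) polyn. homogeneous i f} = card (natpermute i CARD('n))"
proof -
  have "polyn.independent (monomial_basis i :: ('n, 'k) polyn set)"
    unfolding polyn.dependent_def
  proof
    assume "\<exists>a\<in>monomial_basis i :: ('n, 'k) polyn set. a \<in> polyn.span (monomial_basis i - {a})"
    then obtain m where m: "(Poly_Mapping.single m 1 :: ('n, 'k) polyn)
        \<in> polyn.span (monomial_basis i - {Poly_Mapping.single m 1})"
      by (auto simp: monomial_basis_def)
    have "polyn.span (monomial_basis i - {Poly_Mapping.single m 1})
        \<subseteq> {f :: ('n, 'k) polyn. Poly_Mapping.lookup f m = 0}"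
      by (rule polyn.span_minimal, force simp: monomial_basis_def lookup_single when_def)
        (rule polyn.subspaceI; simp add: lookup_add lookup_pscale)
    with m show False by auto
  qed
  then have "polyn.dim {f :: ('n, 'k) polyn. homogeneous i f} = card (monomial_basis i :: ('n, 'k) polyn set)"
    unfolding homogeneous_eq_span by (rule polyn.dim_span_eq_card_independent)
  also have "\<dots> = card {m :: 'n \<Rightarrow>\<^sub>0 nat. monom_degree m = i}"
    unfolding monomial_basis_def
  proof (rule card_image, rule inj_onI)
    fix m m' :: "'n \<Rightarrow>\<^sub>0 nat"
    assume "Poly_Mapping.single m (1 :: 'k) = Poly_Mapping.single m' 1"
    then have "Poly_Mapping.keys (Poly_Mapping.single m (1 :: 'k)) =
        Poly_Mapping.keys (Poly_Mapping.single m' (1 :: 'k))" by simp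
    then show "m = m'" by simp
  qed
  finally show ?thesis by (simp add: card_monom_degree)
qed

text \<open>
  The values are integers, because the recurrence along a regular sequence subtracts them.
\<close>

definition hilbert_function :: "('n::finite, 'k::field) polyn set \<Rightarrow> nat \<Rightarrow> int" where
  "hilbert_function J i =
     int (polyn.dim {f :: ('n, 'k) polyn. homogeneous i f}) - int (polyn.dim (J \<inter> {f. homogeneous i f}))"

definition hilbert_series :: "('n::finite, 'k::field) polyn set \<Rightarrow> int fps" where
  "hilbert_series J = Abs_fps (hilbert_function J)"

lemma one_minus_X_times_geometric: "(1 - fps_X) * Abs_fps (\<lambda>_. 1) = (1 :: int fps)"
  by (rule fps_ext) (simp add: left_diff_distrib fps_X_mult_nth)

lemma hilbert_series_zero_ideal:
  "hilbert_series ({0} :: ('n::finite, 'k::field) polyn set) * (1 - fps_X) ^ CARD('n) = 1"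
proof -
  have "hilbert_series ({0} :: ('n, 'k) polyn set) = Abs_fps (\<lambda>_. 1) ^ CARD('n)"
  proof (rule fps_ext)
    fix i
    have "{0} \<inter> {f :: ('n, 'k) polyn. homogeneous i f} = {0}" by (auto simp: homogeneous_0)
    then have "fps_nth (hilbert_series ({0} :: ('n, 'k) polyn set)) i = int (card (natpermute i CARD('n)))"
      by (simp add: hilbert_series_def hilbert_function_def dim_homogeneous polyn.dim_zero_subspace)
    then show "fps_nth (hilbert_series ({0} :: ('n, 'k) polyn set)) i = fps_nth (Abs_fps (\<lambda>_. 1) ^ CARD('n)) i"
      by (simp add: fps_power_nth)
  qed
  then show ?thesis
    by (metis mult.commute one_minus_X_times_geometric power_mult_distrib power_one)
qed

text \<open>
  In the exact sequence \<open>0 \<rightarrow> (R / J)(-d) \<rightarrow> R / J \<rightarrow> R / (J, f) \<rightarrow> 0\<close> the first map is multiplication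
  by \<open>f\<close>. Degree by degree this is an instance of the dimension formula for images modulo a subspace.
\<close>

lemma hilbert_series_insert:
  fixes f :: "('n::finite, 'k::field) polyn"
  assumes J: "homogeneous_ideal (Idl\<^bsub>polyn_ring\<^esub> S)" and f: "homogeneous d f"
    and nzd: "\<And>g. f * g \<in> Idl\<^bsub>polyn_ring\<^esub> S \<Longrightarrow> g \<in> Idl\<^bsub>polyn_ring\<^esub> S"
  shows "hilbert_series (Idl\<^bsub>polyn_ring\<^esub> (insert f S)) =
    hilbert_series (Idl\<^bsub>polyn_ring\<^esub> S) * (1 - fps_X ^ d)"
proof (rule fps_ext)
  fix i
  let ?J = "Idl\<^bsub>polyn_ring\<^esub> S" and ?J' = "Idl\<^bsub>polyn_ring\<^esub> (insert f S)"
  let ?V = "\<lambda>i. {g :: ('n, 'k) polyn. homogeneous i g}"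
  have I: "ideal ?J polyn_ring" by (rule ideal_Idl)
  have mem: "x \<in> ?J' \<inter> ?V i \<longleftrightarrow>
      (\<exists>a g. x = a + f * g \<and> a \<in> ?J \<inter> ?V i \<and> (if d \<le> i then g \<in> ?V (i - d) else g = 0))" for x
  proof
    assume x: "x \<in> ?J' \<inter> ?V i"
    then obtain a g where ag: "x = a + f * g" "a \<in> ?J" by (auto simp: Idl_insert)
    have "x = homogeneous_component i x" using x homogeneous_component_homogeneous[of i x i] by simp
    also have "\<dots> = homogeneous_component i a + f * (if d \<le> i then homogeneous_component (i - d) g else 0)"
      unfolding ag homogeneous_component_add homogeneous_component_mult[OF f] by simp
    finally show "\<exists>a g. x = a + f * g \<and> a \<in> ?J \<inter> ?V i \<and> (if d \<le> i then g \<in> ?V (i - d) else g = 0)"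
      using J ag(2) homogeneous_homogeneous_component by (fastforce simp: homogeneous_ideal_def)
  next
    assume "\<exists>a g. x = a + f * g \<and> a \<in> ?J \<inter> ?V i \<and> (if d \<le> i then g \<in> ?V (i - d) else g = 0)"
    then obtain a g where ag: "x = a + f * g" "a \<in> ?J \<inter> ?V i"
      "if d \<le> i then g \<in> ?V (i - d) else g = 0" by blast
    have "f * g \<in> ?V i"
      using ag(3) homogeneous_mult[OF f, of "i - d" g] by (auto simp: homogeneous_0 split: if_splits)
    then have "x \<in> ?V i" using ag(1,2) by (simp add: homogeneous_add)
    then show "x \<in> ?J' \<inter> ?V i" using ag by (auto simp: Idl_insert)
  qed
  have "hilbert_function ?J' i =
      hilbert_function ?J i - (if i < d then 0 else hilbert_function ?J (i - d))"
  proof (cases "i < d")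
    case True
    then have "?J' \<inter> ?V i = ?J \<inter> ?V i" using mem by (auto simp del: IntI IntE Int_iff)
    with True show ?thesis by (simp add: hilbert_function_def)
  next
    case False
    then have "?J' \<inter> ?V i = {a + f * g | a g. a \<in> ?J \<inter> ?V i \<and> g \<in> ?V (i - d)}"
      using mem by (auto simp del: IntI IntE Int_iff)
    moreover have "polyn.dim {a + f * g | a g. a \<in> ?J \<inter> ?V i \<and> g \<in> ?V (i - d)}
        + polyn.dim (?J \<inter> ?V (i - d)) = polyn.dim (?J \<inter> ?V i) + polyn.dim (?V (i - d))"
    proof (rule polyn.dim_image_mod_subspace[OF module_hom_times subspace_homogeneous])
      show "polyn.subspace (?J \<inter> ?V (i - d))" "polyn.subspace (?J \<inter> ?V i)"
        by (intro polyn.subspace_inter subspace_ideal[OF I] subspace_homogeneous)+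
      show "?V (i - d) \<subseteq> polyn.span (monomial_basis (i - d))"
        by (simp add: homogeneous_eq_span)
      show "?J \<inter> ?V i \<subseteq> polyn.span (monomial_basis i)"
        by (auto simp flip: homogeneous_eq_span)
      fix g assume "g \<in> ?V (i - d)"
      then have "f * g \<in> ?V i"
        using homogeneous_mult[OF f, of "i - d" g] False by simp
      then show "f * g \<in> ?J \<inter> ?V i \<longleftrightarrow> g \<in> ?J \<inter> ?V (i - d)"
        using nzd ideal_mult[OF I, of g f] \<open>g \<in> ?V (i - d)\<close> by auto
    qed (auto simp: finite_monomial_basis)
    ultimately show ?thesis using False by (simp add: hilbert_function_def)
  qed
  then show "fps_nth (hilbert_series ?J') i = fps_nth (hilbert_series ?J * (1 - fps_X ^ d)) i"
    by (simp add: hilbert_series_def right_diff_distrib fps_X_power_mult_right_nth)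
qed

lemma hilbert_series_regular_sequence:
  fixes F :: "nat \<Rightarrow> ('n::finite, 'k::field) polyn"
  assumes "\<And>i. i \<in> {1..r} \<Longrightarrow> homogeneous (d i) (F i)"
    and "\<And>i g. i \<in> {1..r} \<Longrightarrow> F i * g \<in> Idl\<^bsub>polyn_ring\<^esub> (F ` {1..<i}) \<Longrightarrow>
      g \<in> Idl\<^bsub>polyn_ring\<^esub> (F ` {1..<i})"
  shows "hilbert_series (Idl\<^bsub>polyn_ring\<^esub> (F ` {1..r})) * (1 - fps_X) ^ CARD('n) =
    (\<Prod>i=1..r. 1 - fps_X ^ d i)"
  using assms
proof (induction r)
  case 0
  then show ?case by (simp add: Idl_empty hilbert_series_zero_ideal)
next
  case (Suc r)
  have IH: "hilbert_series (Idl\<^bsub>polyn_ring\<^esub> (F ` {1..r})) * (1 - fps_X) ^ CARD('n) =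
      (\<Prod>i=1..r. 1 - fps_X ^ d i)"
    using Suc.prems by (intro Suc.IH) auto
  have eq: "F ` {1..Suc r} = insert (F (Suc r)) (F ` {1..r})"
    by (simp add: atLeastAtMostSuc_conv)
  have "{1..<Suc r} = {1..r}" by auto
  then have nzd: "\<And>g. F (Suc r) * g \<in> Idl\<^bsub>polyn_ring\<^esub> (F ` {1..r}) \<Longrightarrow>
      g \<in> Idl\<^bsub>polyn_ring\<^esub> (F ` {1..r})"
    using Suc.prems(2)[of "Suc r"] by simp
  have "homogeneous_ideal (Idl\<^bsub>polyn_ring\<^esub> (F ` {1..r}))"
    using Suc.prems(1) by (intro homogeneous_ideal_Idl[of _ d]) auto
  then have "hilbert_series (Idl\<^bsub>polyn_ring\<^esub> (F ` {1..Suc r})) =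
      hilbert_series (Idl\<^bsub>polyn_ring\<^esub> (F ` {1..r})) * (1 - fps_X ^ d (Suc r))"
    unfolding eq using Suc.prems(1)[of "Suc r"] nzd by (intro hilbert_series_insert) auto
  then show ?case using IH by (simp add: mult.assoc mult.left_commute mult.commute)
qed

lemma fps_mult_degree_bound:
  fixes f g :: "int fps"
  assumes "\<And>k. k > a \<Longrightarrow> fps_nth f k = 0" "\<And>k. k > b \<Longrightarrow> fps_nth g k = 0" "k > a + b"
  shows "fps_nth (f * g) k = 0"
  unfolding fps_mult_nth
proof (rule sum.neutral, rule ballI)
  fix i assume "i \<in> {0..k}"
  with assms(3) have "i > a \<or> k - i > b" by auto
  then show "fps_nth f i * fps_nth g (k - i) = 0" using assms(1,2) by auto
qed

lemma fps_prod_degree_bound: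
  fixes f :: "'a \<Rightarrow> int fps"
  assumes "finite A" "\<And>x k. x \<in> A \<Longrightarrow> k > b x \<Longrightarrow> fps_nth (f x) k = 0" "k > sum b A"
  shows "fps_nth (prod f A) k = 0"
  using assms
proof (induction arbitrary: k)
  case (insert x A)
  then show ?case
    using fps_mult_degree_bound[of "b x" "f x" "sum b A" "prod f A" k] by simp
qed simp

text \<open>
  One form fewer than there are variables leaves a single factor \<open>1 - X\<close> in the denominator of the
  Hilbert series. Multiplied by \<open>1 - X\<close>, the series becomes the product of the polynomials
  \<open>1 + X + \<dots> + X ^ (d i - 1)\<close>. The degree of this product is the bound on \<open>m\<close>, and its coefficients are
  the differences of consecutive values of the Hilbert function.
\<close>

lemma hilbert_function_eventually_constant:
  fixes F :: "nat \<Rightarrow> ('n::finite, 'k::field) polyn"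
  assumes r: "Suc r = CARD('n)"
    and hom: "\<And>i. i \<in> {1..r} \<Longrightarrow> homogeneous (d i) (F i)"
    and nzd: "\<And>i g. i \<in> {1..r} \<Longrightarrow> F i * g \<in> Idl\<^bsub>polyn_ring\<^esub> (F ` {1..<i}) \<Longrightarrow>
      g \<in> Idl\<^bsub>polyn_ring\<^esub> (F ` {1..<i})"
    and m: "m \<ge> (\<Sum>i=1..r. d i - 1)"
  shows "hilbert_function (Idl\<^bsub>polyn_ring\<^esub> (F ` {1..r})) (Suc m) =
    hilbert_function (Idl\<^bsub>polyn_ring\<^esub> (F ` {1..r})) m"
proof -
  let ?H = "hilbert_series (Idl\<^bsub>polyn_ring\<^esub> (F ` {1..r}))"
  let ?G = "\<lambda>i. \<Sum>t<d i. fps_X ^ t :: int fps"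
  have "(?H * (1 - fps_X)) * (1 - fps_X) ^ r = ?H * (1 - fps_X) ^ CARD('n)"
    by (simp flip: r add: mult.assoc)
  also have "\<dots> = (\<Prod>i=1..r. 1 - fps_X ^ d i)"
    by (rule hilbert_series_regular_sequence[OF hom nzd])
  also have "\<dots> = (\<Prod>i=1..r. (1 - fps_X) * ?G i)"
    by (rule prod.cong[OF refl]) (rule one_diff_power_eq)
  also have "\<dots> = prod ?G {1..r} * (1 - fps_X) ^ r"
    by (simp add: prod.distrib)
  finally have "?H * (1 - fps_X) = prod ?G {1..r}"
  proof -
    have "(1 - fps_X :: int fps) \<noteq> 0"
      using one_minus_X_times_geometric by auto
    then show "?H * (1 - fps_X) * (1 - fps_X) ^ r = prod ?G {1..r} * (1 - fps_X) ^ r \<Longrightarrow> ?thesis"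
      by simp
  qed
  moreover have "fps_nth (prod ?G {1..r}) (Suc m) = 0"
    using m by (intro fps_prod_degree_bound[of _ "\<lambda>i. d i - 1"])
      (auto simp: fps_sum_nth fps_X_power_nth intro!: sum.neutral)
  ultimately have "fps_nth (?H * (1 - fps_X)) (Suc m) = 0" by simp
  then show ?thesis by (simp add: right_diff_distrib hilbert_series_def)
qed

section \<open>Linear forms\<close>

definition pvar :: "'n \<Rightarrow> ('n, 'k::field) polyn" where
  "pvar x = Poly_Mapping.single (Poly_Mapping.single x 1) 1"

lemma linear_form_eq: "linear_form c = (\<Sum>x\<in>UNIV. pscale (c x) (pvar x))"
  by (simp add: linear_form_def pscale_def pvar_def mult_single)

lemma homogeneous_pvar: "homogeneous 1 (pvar x)"
  using homogeneous_single[of "Poly_Mapping.single x 1" 1]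
  by (simp add: pvar_def monom_degree_single)

lemma homogeneous_linear_form: "homogeneous 1 (linear_form c)"
  unfolding linear_form_eq by (intro homogeneous_sum homogeneous_pscale homogeneous_pvar)

lemma homogeneous_SucE:
  fixes f :: "('n::finite, 'k::field) polyn"
  assumes "homogeneous (Suc i) f"
  obtains g where "\<And>x. homogeneous i (g x)" "f = (\<Sum>x\<in>UNIV. pvar x * g x)"
proof -
  let ?D = "{f :: ('n, 'k) polyn. \<exists>g. (\<forall>x. homogeneous i (g x)) \<and> f = (\<Sum>x\<in>UNIV. pvar x * g x)}"
  have "polyn.subspace ?D"
  proof (rule polyn.subspaceI)
    show "0 \<in> ?D" by (auto simp: homogeneous_0 intro!: exI[of _ "\<lambda>_. 0"])
  next
    fix a b assume "a \<in> ?D" "b \<in> ?D"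
    then obtain g h where gh: "\<forall>x. homogeneous i (g x)" "a = (\<Sum>x\<in>UNIV. pvar x * g x)"
      "\<forall>x. homogeneous i (h x)" "b = (\<Sum>x\<in>UNIV. pvar x * h x)" by blast
    then show "a + b \<in> ?D"
      by (auto simp: homogeneous_add distrib_left sum.distrib intro!: exI[of _ "\<lambda>x. g x + h x"])
  next
    fix c a assume "a \<in> ?D"
    then obtain g where g: "\<forall>x. homogeneous i (g x)" "a = (\<Sum>x\<in>UNIV. pvar x * g x)" by blast
    then show "pscale c a \<in> ?D"
      by (auto simp: homogeneous_pscale polyn.scale_sum_right pscale_mult_right
          intro!: exI[of _ "\<lambda>x. pscale c (g x)"])
  qed
  moreover have "monomial_basis (Suc i) \<subseteq> ?D"
  proof
    fix f :: "('n, 'k) polyn" assume "f \<in> monomial_basis (Suc i)"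
    then obtain m where f: "f = Poly_Mapping.single m 1" and m: "monom_degree m = Suc i"
      by (auto simp: monomial_basis_def)
    from m obtain x where x: "Poly_Mapping.lookup m x \<noteq> 0"
      unfolding monom_degree_def by fastforce
    define k where "k = m - Poly_Mapping.single x 1"
    have mk: "m = Poly_Mapping.single x 1 + k"
      using x unfolding k_def
      by (intro poly_mapping_eqI) (auto simp: lookup_add lookup_minus lookup_single when_def)
    then have k: "monom_degree k = i"
      using m by (simp add: monom_degree_add monom_degree_single)
    let ?g = "\<lambda>y. if y = x then Poly_Mapping.single k (1 :: 'k) else 0"
    have "(\<Sum>y\<in>UNIV. pvar y * ?g y) = (\<Sum>y\<in>UNIV. if y = x then pvar x * Poly_Mapping.single k 1 else 0)"
      by (rule sum.cong) auto
    also have "\<dots> = f"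
      by (simp add: f mk pvar_def mult_single)
    finally have "f = (\<Sum>y\<in>UNIV. pvar y * ?g y)" ..
    moreover have "\<forall>y. homogeneous i (?g y)"
      using homogeneous_single[of k 1] k by (auto simp: homogeneous_0)
    ultimately show "f \<in> ?D" by (intro CollectI exI[of _ ?g] conjI)
  qed
  ultimately have "polyn.span (monomial_basis (Suc i)) \<subseteq> ?D"
    by (intro polyn.span_minimal)
  with assms have "f \<in> ?D" unfolding homogeneous_eq_span[symmetric] by blast
  then show thesis using that by blast
qed

text \<open>
  A form of positive degree lies in the ideal generated by the variables, so it kills every class
  that all the variables kill.
\<close>

lemma ideal_saturated_if_nonzerodivisor:
  assumes J: "ideal J polyn_ring" and f: "homogeneous d f" "0 < d"
    and nzd: "\<And>g. f * g \<in> J \<Longrightarrow> g \<in> J" and a: "\<And>x. pvar x * a \<in> J"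
  shows "a \<in> J"
proof (rule nzd)
  obtain i where "d = Suc i" using f(2) by (cases d) auto
  then obtain g where "f = (\<Sum>x\<in>UNIV. pvar x * g x)" using homogeneous_SucE[of i f] f(1) by auto
  then have "f * a = (\<Sum>x\<in>UNIV. g x * (pvar x * a))"
    by (simp add: sum_distrib_left sum_distrib_right ac_simps)
  also have "\<dots> \<in> J" by (intro ideal_sum[OF J] ideal_mult[OF J] a)
  finally show "f * a \<in> J" .
qed

section \<open>A general linear form is injective in one degree\<close>

text \<open>
  McCoy's theorem for the polynomial \<open>\<Sum>j<N. y j * s ^ j\<close> over \<open>R / J\<close>: if only zero is killed by all
  the coefficients \<open>y j\<close>, then only the zero polynomial \<open>\<Sum>t. g t * s ^ t\<close> is killed by it. The
  proof is by induction on a strict bound for the degree of the second polynomial, going down through the \<open>y j\<close>: once all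
  \<open>y i\<close> with \<open>i > j\<close> are known to kill \<open>g\<close>, the coefficient of \<open>s ^ (j + K)\<close> of the product shows that
  \<open>y j\<close> kills the leading coefficient of \<open>g\<close>, so \<open>y j * g\<close> has smaller degree and vanishes by
  induction.
\<close>

lemma McCoy:
  fixes y g :: "nat \<Rightarrow> ('n, 'k::field) polyn"
  assumes J: "ideal J polyn_ring"
    and faithful: "\<And>a. (\<And>j. j < N \<Longrightarrow> y j * a \<in> J) \<Longrightarrow> a \<in> J"
    and bound: "\<And>t. t \<ge> K \<Longrightarrow> g t \<in> J"
    and product: "\<And>u. (\<Sum>i | i < N \<and> i \<le> u. y i * g (u - i)) \<in> J"
  shows "g t \<in> J"
  using bound product
proof (induction K arbitrary: g t)
  case 0
  then show ?case by simp
next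
  case (Suc K)
  have "\<forall>t. y j * g t \<in> J" if "j < N" for j
    using that
  proof (induction "N - j" arbitrary: j rule: less_induct)
    case less
    have above: "y i * g t \<in> J" if "j < i" "i < N" for i t
      using less.hyps[of i] that less.prems by auto
    have rest: "(\<Sum>i\<in>{i. i < N \<and> i \<le> j + K} - {j}. y i * g (j + K - i)) \<in> J"
    proof (rule ideal_sum[OF J])
      fix i assume i: "i \<in> {i. i < N \<and> i \<le> j + K} - {j}"
      show "y i * g (j + K - i) \<in> J"
      proof (cases "j < i")
        case True
        then show ?thesis using above i by auto
      next
        case False
        then have "g (j + K - i) \<in> J" using i by (intro Suc.prems(1)) auto
        then show ?thesis by (rule ideal_mult[OF J])
      qed
    qed
    have "(\<Sum>i | i < N \<and> i \<le> j + K. y i * g (j + K - i)) =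
        y j * g K + (\<Sum>i\<in>{i. i < N \<and> i \<le> j + K} - {j}. y i * g (j + K - i))"
      using less.prems by (subst sum.remove[of _ j]) auto
    with Suc.prems(2)[of "j + K"] have top: "y j * g K \<in> J"
      using ideal_add_cancel[OF J rest, of "y j * g K"] by (simp add: add.commute)
    show ?case
    proof
      fix t
      show "y j * g t \<in> J"
      proof (rule Suc.IH)
        fix t assume "t \<ge> K"
        then show "y j * g t \<in> J"
          using top Suc.prems(1)[of t] ideal_mult[OF J, of "g t" "y j"] by (cases "t = K") auto
      next
        fix u
        have "(\<Sum>i | i < N \<and> i \<le> u. y i * (y j * g (u - i))) =
            y j * (\<Sum>i | i < N \<and> i \<le> u. y i * g (u - i))"
          by (simp add: sum_distrib_left mult.left_commute)
        then show "(\<Sum>i | i < N \<and> i \<le> u. y i * (y j * g (u - i))) \<in> J"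
          using ideal_mult[OF J Suc.prems(2)[of u]] by simp
      qed
    qed
  qed
  then have "y j * g t \<in> J" if "j < N" for j using that by simp
  then show ?case by (rule faithful)
qed

lemma polyn_eval_add: "polyn_eval (f + g) c = polyn_eval f c + polyn_eval g c"
  unfolding polyn_eval_def by (rule setsum_keys_plus_distrib) (simp_all add: distrib_right)

lemma polyn_eval_single:
  "polyn_eval (Poly_Mapping.single m a) c = a * (\<Prod>i\<in>UNIV. c i ^ Poly_Mapping.lookup m i)"
  by (simp add: polyn_eval_def)

lemma polyn_eval_0: "polyn_eval 0 c = 0"
  by (simp add: polyn_eval_def)

lemma polyn_eval_mult: "polyn_eval (f * g) c = polyn_eval f c * polyn_eval g c"
proof (induction f rule: polyn_induct)
  case (single m a)
  show ?case
    by (induction g rule: polyn_induct)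
      (simp_all add: polyn_eval_0 polyn_eval_add polyn_eval_single mult_single distrib_left
        lookup_add power_add prod.distrib)
qed (simp_all add: polyn_eval_0 polyn_eval_add distrib_right)

lemma comm_ring_hom_polyn_eval: "comm_ring_hom (\<lambda>f. polyn_eval f c)"
  by unfold_locales
    (simp_all add: polyn_eval_0 polyn_eval_add polyn_eval_mult
      polyn_eval_single[of 0 1, simplified])

lemma polyn_eval_sum: "polyn_eval (sum f A) c = (\<Sum>x\<in>A. polyn_eval (f x) c)"
  by (induction A rule: infinite_finite_induct) (simp_all add: polyn_eval_0 polyn_eval_add)

lemma polyn_eval_linear_form: "polyn_eval (linear_form b) c = (\<Sum>x\<in>UNIV. b x * c x)"
proof -
  have "(\<Prod>i\<in>UNIV. c i ^ (1 when x = i)) = (\<Prod>i\<in>UNIV. if i = x then c x else 1)" for x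
    by (rule prod.cong) auto
  then show ?thesis
    by (simp add: linear_form_def polyn_eval_sum polyn_eval_single lookup_single)
qed

lemma lookup_linear_form_mult:
  "Poly_Mapping.lookup (linear_form c * g) m = (\<Sum>x\<in>UNIV. c x * Poly_Mapping.lookup (pvar x * g) m)"
proof -
  have "linear_form c * g = (\<Sum>x\<in>UNIV. pscale (c x) (pvar x * g))"
    by (simp add: linear_form_eq sum_distrib_right pscale_def mult.assoc)
  then show ?thesis by (simp add: lookup_sum lookup_pscale)
qed

lemma sum_lessThan_add:
  fixes f :: "nat \<Rightarrow> 'a::comm_monoid_add"
  shows "sum f {..<p + q} = sum f {..<p} + (\<Sum>l<q. f (p + l))"
  by (induction q) (simp_all add: add.assoc)

lemma homogeneous_quotient_basisE:
  fixes J :: "('n::finite, 'k::field) polyn set"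
  assumes J: "ideal J polyn_ring"
  obtains p r where "polyn.quotient_basis {f. homogeneous i f} (J \<inter> {f. homogeneous i f}) p r"
    and "polyn.dim {f :: ('n, 'k) polyn. homogeneous i f} = polyn.dim (J \<inter> {f. homogeneous i f}) + p"
proof -
  let ?V = "{f :: ('n, 'k) polyn. homogeneous i f}"
  have sub: "polyn.subspace (J \<inter> ?V)"
    by (intro polyn.subspace_inter subspace_ideal[OF J] subspace_homogeneous)
  have sp: "?V \<subseteq> polyn.span (monomial_basis i)" by (simp add: homogeneous_eq_span)
  obtain p r where qb: "polyn.quotient_basis ?V (J \<inter> ?V) p r"
    using polyn.quotient_basis_exists[OF sub _ finite_monomial_basis sp] by auto
  show thesis
    using that[OF qb] polyn.dim_quotient_basis[OF sub subspace_homogeneous _ finite_monomial_basis sp qb]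
    by simp
qed

lemma homogeneous_ideal_basisE:
  fixes J :: "('n::finite, 'k::field) polyn set"
  assumes J: "ideal J polyn_ring"
  obtains q b where "polyn.quotient_basis (J \<inter> {f. homogeneous i f}) {0} q b"
    and "polyn.dim (J \<inter> {f :: ('n, 'k) polyn. homogeneous i f}) = q"
proof -
  let ?W = "J \<inter> {f :: ('n, 'k) polyn. homogeneous i f}"
  have sub: "polyn.subspace ?W"
    by (intro polyn.subspace_inter subspace_ideal[OF J] subspace_homogeneous)
  have z: "polyn.subspace {0 :: ('n, 'k) polyn}" "{0} \<subseteq> ?W"
    using polyn.subspace_0[OF sub] by simp_all
  have sp: "?W \<subseteq> polyn.span (monomial_basis i)" by (auto simp flip: homogeneous_eq_span)
  obtain q b where qb: "polyn.quotient_basis ?W {0} q b"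
    using polyn.quotient_basis_exists[OF z finite_monomial_basis sp] .
  show thesis
    using that[OF qb] polyn.dim_quotient_basis[OF z(1) sub z(2) finite_monomial_basis sp qb]
    by (simp add: polyn.dim_zero_subspace)
qed

text \<open>
  Choose representatives \<open>r j\<close> of a basis of \<open>(R / J)\<close> in degree \<open>m\<close> and a basis \<open>b l\<close> of \<open>J\<close> in degree
  \<open>m + 1\<close>. Multiplication by \<open>L\<close> is injective modulo \<open>J\<close> in degree \<open>m\<close> if the forms \<open>L * r j\<close> and
  \<open>b l\<close> are linearly independent. Because the Hilbert function takes the same value in degrees \<open>m\<close>
  and \<open>m + 1\<close>, there are as many of these forms as monomials of degree \<open>m + 1\<close>; hence their
  coefficient matrix \<open>M\<close> is square. Its determinant is a polynomial in the coefficients of \<open>L\<close>, and \<open>U\<close> is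
  the set where this polynomial does not vanish.

  To see that \<open>U\<close> is nonempty, restrict to the curve of linear forms \<open>\<Sum>i<n. s ^ i * x\<^sub>i\<close>. If the
  determinant vanished identically in \<open>s\<close>, the matrix would have a nonzero kernel vector with entries
  in \<open>k[s]\<close>. That is a polynomial over \<open>R / J\<close> killed by \<open>\<Sum>i<n. x\<^sub>i * s ^ i\<close>, and McCoy's theorem makes
  it zero. So the determinant is a nonzero polynomial in \<open>s\<close>, and over an infinite field some value of
  \<open>s\<close> is not a root.
\<close>

lemma general_linear_form_injective:
  fixes J :: "('n::finite, 'k::field) polyn set"
  assumes inf: "infinite (UNIV :: 'k set)"
    and J: "ideal J polyn_ring"
    and sat: "\<And>a. (\<And>x. pvar x * a \<in> J) \<Longrightarrow> a \<in> J"
    and dims: "hilbert_function J (Suc m) = hilbert_function J m"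
  obtains U where "zariski_open U" "U \<noteq> {}"
    "\<And>c g. c \<in> U \<Longrightarrow> homogeneous m g \<Longrightarrow> linear_form c * g \<in> J \<Longrightarrow> g \<in> J"
proof -
  let ?V = "\<lambda>i. {f :: ('n, 'k) polyn. homogeneous i f}"
  let ?lk = "Poly_Mapping.lookup"
  obtain p r where r: "polyn.quotient_basis (?V m) (J \<inter> ?V m) p r"
    and p: "polyn.dim (?V m) = polyn.dim (J \<inter> ?V m) + p"
    using homogeneous_quotient_basisE[OF J] .
  obtain q b where b: "polyn.quotient_basis (J \<inter> ?V (Suc m)) {0} q b"
    and q: "polyn.dim (J \<inter> ?V (Suc m)) = q"
    using homogeneous_ideal_basisE[OF J] .
  have rV: "homogeneous m (r j)" if "j < p" for j
    using r that by (simp add: polyn.quotient_basis_def)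
  have bJ: "b l \<in> J" "homogeneous (Suc m) (b l)" if "l < q" for l
    using b that by (simp_all add: polyn.quotient_basis_def)
  define N where "N = p + q"
  have "polyn.dim (?V (Suc m)) = N"
    using dims p q by (simp add: hilbert_function_def N_def)
  then have "card {k :: 'n \<Rightarrow>\<^sub>0 nat. monom_degree k = Suc m} = N"
    by (simp add: dim_homogeneous card_monom_degree)
  then obtain mon :: "nat \<Rightarrow> 'n \<Rightarrow>\<^sub>0 nat"
    where mon: "bij_betw mon {..<N} {k. monom_degree k = Suc m}"
    using ex_bij_betw_nat_finite[OF finite_monom_degree] by (metis atLeast0LessThan)
  have eq0: "f = 0" if "homogeneous (Suc m) f" "\<And>a. a < N \<Longrightarrow> ?lk f (mon a) = 0"
    for f :: "('n, 'k) polyn"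
  proof (rule poly_mapping_eqI)
    fix k
    show "?lk f k = ?lk 0 k"
    proof (cases "monom_degree k = Suc m")
      case True
      then obtain a where "a < N" "k = mon a" using bij_betw_imp_surj_on[OF mon] by blast
      then show ?thesis using that by simp
    next
      case False
      then show ?thesis using that by (simp add: homogeneous_altdef)
    qed
  qed
  define v where "v c j = (if j < p then linear_form c * r j else b (j - p))" for c j
  (* M c is the coefficient matrix for the linear form with coefficients c, and P is the same matrix
     with these coefficients taken as variables *)
  define M where "M c = mat N N (\<lambda>(a, j). ?lk (v c j) (mon a))" for c
  define P where "P = mat N N (\<lambda>(a, j). if j < p then linear_form (\<lambda>x. ?lk (pvar x * r j) (mon a))
      else Poly_Mapping.single 0 (?lk (b (j - p)) (mon a)))"
  have M_carrier: "M c \<in> carrier_mat N N" for c by (simp add: M_def)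
  have vhom: "homogeneous (Suc m) (v c j)" if "j < N" for c j
    using that homogeneous_mult[OF homogeneous_linear_form rV, of j c] bJ(2)[of "j - p"]
    by (auto simp: v_def N_def)
  have det_P: "polyn_eval (det P) c = det (M c)" for c
  proof -
    interpret ev: comm_ring_hom "\<lambda>f. polyn_eval f c" by (rule comm_ring_hom_polyn_eval)
    have "map_mat (\<lambda>f. polyn_eval f c) P = M c"
      by (rule eq_matI)
        (auto simp: P_def M_def v_def polyn_eval_linear_form lookup_linear_form_mult
          polyn_eval_single mult.commute)
    then show ?thesis by (metis ev.hom_det)
  qed
  define U where "U = {c. det (M c) \<noteq> 0}"
  have "zariski_open U"
    unfolding zariski_open_def by (rule exI[of _ "{det P}"]) (auto simp: U_def det_P)
  moreover have "g \<in> J"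
    if c: "c \<in> U" and g: "homogeneous m g" "linear_form c * g \<in> J" for c g
  proof -
    obtain a where a: "g - (\<Sum>i<p. pscale (a i) (r i)) \<in> J \<inter> ?V m"
      using r g(1) unfolding polyn.quotient_basis_def by blast
    define h where "h = (\<Sum>i<p. pscale (a i) (r i))"
    have h: "homogeneous m h"
      unfolding h_def by (intro homogeneous_sum homogeneous_pscale rV) auto
    have "linear_form c * (g - h) \<in> J" using a ideal_mult[OF J] by (simp add: h_def)
    then have "linear_form c * g - linear_form c * (g - h) \<in> J" by (rule ideal_diff[OF J g(2)])
    then have "linear_form c * h \<in> J \<inter> ?V (Suc m)"
      using homogeneous_mult[OF homogeneous_linear_form h, of c] by (simp add: right_diff_distrib)
    then obtain s where s: "linear_form c * h - (\<Sum>l<q. pscale (s l) (b l)) \<in> {0}"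
      using b unfolding polyn.quotient_basis_def by blast
    define w where "w = vec N (\<lambda>j. if j < p then a j else - s (j - p))"
    have comb: "(\<Sum>j<N. pscale (w $ j) (v c j)) = 0"
    proof -
      have "(\<Sum>j<p. pscale (w $ j) (v c j)) = linear_form c * h"
        by (simp add: w_def v_def N_def h_def sum_distrib_left pscale_mult_right)
      moreover have "(\<Sum>l<q. pscale (w $ (p + l)) (v c (p + l))) = - (\<Sum>l<q. pscale (s l) (b l))"
        by (simp add: w_def v_def N_def sum_negf)
      ultimately show ?thesis using s by (simp add: N_def sum_lessThan_add)
    qed
    have "M c *\<^sub>v w = 0\<^sub>v N"
    proof (rule eq_vecI)
      fix k assume k: "k < dim_vec (0\<^sub>v N)"
      then have "(M c *\<^sub>v w) $ k = ?lk (\<Sum>j<N. pscale (w $ j) (v c j)) (mon k)"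
        by (simp add: M_def w_def scalar_prod_def lookup_sum lookup_pscale mult.commute atLeast0LessThan)
      then show "(M c *\<^sub>v w) $ k = 0\<^sub>v N $ k" using k comb by simp
    qed (simp add: M_def)
    moreover have "w \<in> carrier_vec N" by (simp add: w_def)
    ultimately have "w = 0\<^sub>v N"
      using c det_0_iff_vec_prod_zero[OF M_carrier[of c]] by (auto simp: U_def)
    then have "w $ j = 0" if "j < N" for j using that by simp
    moreover have "a j = w $ j" if "j < p" for j using that by (simp add: w_def N_def)
    ultimately have "a j = 0" if "j < p" for j using that by (simp add: N_def)
    then have "h = 0" by (simp add: h_def)
    then show "g \<in> J" using a by (simp add: h_def)
  qed
  moreover have "U \<noteq> {}"
  proof -
    define n where "n = CARD('n)"
    obtain e :: "nat \<Rightarrow> 'n" where e: "bij_betw e {..<n} UNIV"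
      using ex_bij_betw_nat_finite[of "UNIV :: 'n set"] by (auto simp: atLeast0LessThan n_def)
    define curve where "curve s x = s ^ the_inv_into {..<n} e x" for s :: 'k and x
    have curve: "curve s (e i) = s ^ i" if "i < n" for s i
      using that e by (simp add: curve_def bij_betw_def the_inv_into_f_f)
    (* the coefficient matrix along the curve, with entries in k[s] *)
    define Q where "Q = mat N N (\<lambda>(a, j). if j < p
        then \<Sum>i<n. Polynomial.monom (?lk (pvar (e i) * r j) (mon a)) i
        else [:?lk (b (j - p)) (mon a):])"
    have Q_carrier: "Q \<in> carrier_mat N N" by (simp add: Q_def)
    have det_Q: "poly (det Q) s = det (M (curve s))" for s
    proof -
      interpret ev: comm_ring_hom "\<lambda>f. poly f s" by unfold_locales simp_all
      have "(\<Sum>x\<in>UNIV. curve s x * ?lk (pvar x * g) k) = (\<Sum>i<n. ?lk (pvar (e i) * g) k * s ^ i)"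
        for g k
        by (subst sum.reindex_bij_betw[OF e, symmetric]) (simp add: curve mult.commute)
      then have "map_mat (\<lambda>f. poly f s) Q = M (curve s)"
        by (intro eq_matI)
          (auto simp: Q_def M_def v_def lookup_linear_form_mult poly_sum poly_monom)
      then show ?thesis by (metis ev.hom_det)
    qed
    have "det Q \<noteq> 0"
    proof
      assume "det Q = 0"
      then obtain w where w: "w \<in> carrier_vec N" "w \<noteq> 0\<^sub>v N" "Q *\<^sub>v w = 0\<^sub>v N"
        using det_0_iff_vec_prod_zero[OF Q_carrier] by blast
      (* g t and \<beta> t collect the coefficients of s ^ t in the two parts of the kernel vector w *)
      define g where "g t = (\<Sum>j<p. pscale (poly.coeff (w $ j) t) (r j))" for t
      define \<beta> where "\<beta> t = (\<Sum>l<q. pscale (poly.coeff (w $ (p + l)) t) (b l))" for t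
      have ghom: "homogeneous m (g t)" for t
        unfolding g_def by (intro homogeneous_sum homogeneous_pscale rV) auto
      have \<beta>hom: "homogeneous (Suc m) (\<beta> t)" for t
        unfolding \<beta>_def by (intro homogeneous_sum homogeneous_pscale bJ) auto
      have \<beta>J: "\<beta> t \<in> J" for t
        unfolding \<beta>_def
        by (intro polyn.subspace_sum polyn.subspace_scale subspace_ideal[OF J] bJ) auto
      (* the coefficient of s ^ u in the relation given by the kernel vector *)
      have rel: "(\<Sum>i | i < n \<and> i \<le> u. pvar (e i) * g (u - i)) + \<beta> u = 0" for u
      proof (rule eq0)
        have "homogeneous (Suc m) (pvar (e i) * g (u - i))" for i
          using homogeneous_mult[OF homogeneous_pvar ghom, of "e i" "u - i"] by simp
        then show "homogeneous (Suc m) ((\<Sum>i | i < n \<and> i \<le> u. pvar (e i) * g (u - i)) + \<beta> u)"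
          by (intro homogeneous_add homogeneous_sum \<beta>hom)
      next
        fix a assume a: "a < N"
        let ?c = "\<lambda>i j. ?lk (pvar (e i) * r j) (mon a)"
        have "0 = (Q *\<^sub>v w) $ a" using w(3) a by simp
        also have "\<dots> = (\<Sum>j<N. Q $$ (a, j) * w $ j)"
          using a w(1) by (simp add: Q_def scalar_prod_def atLeast0LessThan)
        also have "\<dots> = (\<Sum>j<p. (\<Sum>i<n. Polynomial.monom (?c i j) i) * w $ j) +
            (\<Sum>l<q. [:?lk (b l) (mon a):] * w $ (p + l))"
          using a by (simp add: Q_def N_def sum_lessThan_add)
        finally have "0 = poly.coeff \<dots> u" by simp
        also have "\<dots> = (\<Sum>j<p. \<Sum>i<n. if i \<le> u then ?c i j * poly.coeff (w $ j) (u - i) else 0) +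
            (\<Sum>l<q. ?lk (b l) (mon a) * poly.coeff (w $ (p + l)) u)"
          by (simp add: coeff_sum sum_distrib_right coeff_monom_mult, intro sum.cong refl, simp)
        also have "(\<Sum>l<q. ?lk (b l) (mon a) * poly.coeff (w $ (p + l)) u) = ?lk (\<beta> u) (mon a)"
          by (simp add: \<beta>_def lookup_sum lookup_pscale mult.commute)
        also have "(\<Sum>j<p. \<Sum>i<n. if i \<le> u then ?c i j * poly.coeff (w $ j) (u - i) else 0) =
            (\<Sum>i<n. if i \<le> u then \<Sum>j<p. poly.coeff (w $ j) (u - i) * ?c i j else 0)"
          by (subst sum.swap) (auto intro!: sum.cong simp: mult.commute)
        also have "\<dots> = (\<Sum>i | i < n \<and> i \<le> u. \<Sum>j<p. poly.coeff (w $ j) (u - i) * ?c i j)"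
          by (subst sum.inter_filter[symmetric]) auto
        also have "\<dots> = ?lk (\<Sum>i | i < n \<and> i \<le> u. pvar (e i) * g (u - i)) (mon a)"
          by (simp add: g_def sum_distrib_left pscale_mult_right lookup_sum lookup_pscale)
        finally show "?lk ((\<Sum>i | i < n \<and> i \<le> u. pvar (e i) * g (u - i)) + \<beta> u) (mon a) = 0"
          by (simp add: lookup_add)
      qed
      define K where "K = Suc (\<Sum>j<p. Polynomial.degree (w $ j))"
      have g0: "g t = 0" if "t \<ge> K" for t
      proof -
        have "Polynomial.degree (w $ j) < t" if "j < p" for j
          using member_le_sum[of j "{..<p}" "\<lambda>j. Polynomial.degree (w $ j)"] that \<open>t \<ge> K\<close>
          by (auto simp: K_def)
        then show ?thesis by (simp add: g_def coeff_eq_0)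
      qed
      have gJ: "g t \<in> J" for t
      proof (rule McCoy[OF J, of n "\<lambda>i. pvar (e i)" K])
        fix a assume a: "\<And>i. i < n \<Longrightarrow> pvar (e i) * a \<in> J"
        have "pvar x * a \<in> J" for x
        proof -
          obtain i where "i < n" "x = e i" using bij_betw_imp_surj_on[OF e] by blast
          then show ?thesis using a by simp
        qed
        then show "a \<in> J" by (rule sat)
      next
        fix t assume "t \<ge> K"
        then show "g t \<in> J" using g0 ideal_zero[OF J] by simp
      next
        fix u
        have "(\<Sum>i | i < n \<and> i \<le> u. pvar (e i) * g (u - i)) = 0 - \<beta> u"
          using rel[of u] by (simp add: eq_neg_iff_add_eq_0)
        then show "(\<Sum>i | i < n \<and> i \<le> u. pvar (e i) * g (u - i)) \<in> J"
          using ideal_diff[OF J ideal_zero[OF J] \<beta>J[of u]] by simp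
      qed
      have wp: "poly.coeff (w $ j) t = 0" if "j < p" for j t
        using r gJ[of t] ghom[of t] that by (auto simp: polyn.quotient_basis_def g_def)
      then have "g t = 0" for t by (simp add: g_def)
      then have "\<beta> u = 0" for u using rel[of u] by simp
      have indep: "s l = 0" if "(\<Sum>l<q. pscale (s l) (b l)) = 0" "l < q" for s l
        using b that by (simp add: polyn.quotient_basis_def)
      have wq: "poly.coeff (w $ (p + l)) t = 0" if "l < q" for l t
        using indep[of "\<lambda>l. poly.coeff (w $ (p + l)) t" l] that \<open>\<beta> t = 0\<close>
        by (simp add: \<beta>_def)
      have "w $ j = 0" if "j < N" for j
      proof (rule poly_eqI)
        fix t
        show "poly.coeff (w $ j) t = poly.coeff 0 t"
          using wp[of j t] wq[of "j - p" t] that by (cases "j < p") (auto simp: N_def)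
      qed
      then have "w = 0\<^sub>v N" using w(1) by (intro eq_vecI) auto
      with w(2) show False by contradiction
    qed
    then have "finite {s. poly (det Q) s = 0}" by (rule poly_roots_finite)
    then obtain s where "poly (det Q) s \<noteq> 0"
      using inf by (metis (mono_tags, lifting) UNIV_I finite_subset mem_Collect_eq subsetI)
    then have "curve s \<in> U" by (simp add: U_def det_Q)
    then show ?thesis by blast
  qed
  ultimately show thesis using that by blast
qed

section \<open>Spreading maximal rank to all degrees\<close>

lemma multiplication_surjective_if_injective:
  fixes J :: "('n::finite, 'k::field) polyn set"
  assumes J: "ideal J polyn_ring" and L: "homogeneous 1 L"
    and inj: "\<And>g. homogeneous m g \<Longrightarrow> L * g \<in> J \<Longrightarrow> g \<in> J"
    and dims: "hilbert_function J (Suc m) = hilbert_function J m"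
    and w: "homogeneous (Suc m) w"
  obtains g where "homogeneous m g" "w - L * g \<in> J"
proof -
  let ?V = "\<lambda>i. {f :: ('n, 'k) polyn. homogeneous i f}"
  let ?W = "{x + L * v | x v. x \<in> J \<inter> ?V (Suc m) \<and> v \<in> ?V m}"
  have sub: "polyn.subspace (J \<inter> ?V i)" for i
    by (intro polyn.subspace_inter subspace_ideal[OF J] subspace_homogeneous)
  have Lhom: "homogeneous (Suc m) (L * v)" if "homogeneous m v" for v
    using homogeneous_mult[OF L that] by simp
  have sp: "?V i \<subseteq> polyn.span (monomial_basis i)" for i by (simp add: homogeneous_eq_span)
  have "polyn.dim ?W + polyn.dim (J \<inter> ?V m) = polyn.dim (J \<inter> ?V (Suc m)) + polyn.dim (?V m)"
  proof (rule polyn.dim_image_mod_subspace[OF module_hom_times subspace_homogeneous sub sub])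
    show "J \<inter> ?V (Suc m) \<subseteq> polyn.span (monomial_basis (Suc m))" using sp by blast
    show "?V m \<subseteq> polyn.span (monomial_basis m)" by (rule sp)
    fix v assume "v \<in> ?V m"
    then show "L * v \<in> J \<inter> ?V (Suc m) \<longleftrightarrow> v \<in> J \<inter> ?V m"
      using inj Lhom ideal_mult[OF J, of v L] by auto
  qed (auto simp: finite_monomial_basis)
  then have dim: "polyn.dim ?W = polyn.dim (?V (Suc m))"
    using dims by (simp add: hilbert_function_def)
  have "polyn.subspace ?W"
  proof -
    interpret L: module_hom pscale pscale "\<lambda>g. L * g" by (rule module_hom_times)
    have "{x + y | x y. x \<in> J \<inter> ?V (Suc m) \<and> y \<in> (\<lambda>g. L * g) ` ?V m} = ?W" by auto
    then show ?thesis
      using polyn.subspace_sums[OF sub L.subspace_image[OF subspace_homogeneous], of "Suc m" m] by simp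
  qed
  moreover have "?W \<subseteq> ?V (Suc m)" using Lhom by (auto simp: homogeneous_add)
  ultimately have "?W = ?V (Suc m)"
    using polyn.subspace_eq_if_dim_eq[OF _ subspace_homogeneous _ finite_monomial_basis sp dim] by blast
  with w obtain x v where "w = x + L * v" "x \<in> J" "homogeneous m v" by blast
  then show thesis using that[of v] by simp
qed

text \<open>
  A class of degree \<open>i < m\<close> killed by \<open>L\<close> is moved up to degree \<open>i + 1\<close> by each variable and is still
  killed by \<open>L\<close> there; a class killed by all the variables is zero.
\<close>

lemma multiplication_injective_below:
  assumes sat: "\<And>a. (\<And>x. pvar x * a \<in> J) \<Longrightarrow> a \<in> J" and J: "ideal J polyn_ring"
    and inj: "\<And>g. homogeneous m g \<Longrightarrow> L * g \<in> J \<Longrightarrow> g \<in> J"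
    and im: "i \<le> m" and g: "homogeneous i g" "L * g \<in> J"
  shows "g \<in> J"
  using im g
proof (induction arbitrary: g rule: inc_induct)
  case base
  then show ?case using inj by blast
next
  case (step i)
  show ?case
  proof (rule sat, rule step.IH)
    fix x
    show "homogeneous (Suc i) (pvar x * g)"
      using homogeneous_mult[OF homogeneous_pvar step.prems(1), of x] by simp
    show "L * (pvar x * g) \<in> J"
      using ideal_mult[OF J step.prems(2), of "pvar x"] by (simp add: mult.left_commute)
  qed
qed

text \<open>
  The algebra is generated in degree one: a form of degree \<open>i + 2\<close> is a combination of variables with
  coefficients of degree \<open>i + 1\<close>, and preimages of these are combined in the same way.
\<close>

lemma multiplication_surjective_above:
  fixes J :: "('n::finite, 'k::field) polyn set"
  assumes J: "ideal J polyn_ring"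
    and surj: "\<And>w. homogeneous (Suc m) w \<Longrightarrow> \<exists>g. homogeneous m g \<and> w - L * g \<in> J"
    and mi: "m \<le> i" and w: "homogeneous (Suc i) w"
  shows "\<exists>g. homogeneous i g \<and> w - L * g \<in> J"
  using mi w
proof (induction arbitrary: w rule: dec_induct)
  case base
  then show ?case using surj by blast
next
  case (step i)
  obtain u where u: "\<And>x. homogeneous (Suc i) (u x)" "w = (\<Sum>x\<in>UNIV. pvar x * u x)"
    using homogeneous_SucE[OF step.prems] by blast
  obtain g where g: "\<And>x. homogeneous i (g x)" "\<And>x. u x - L * g x \<in> J"
    using step.IH[OF u(1)] by metis
  have "homogeneous (Suc i) (\<Sum>x\<in>UNIV. pvar x * g x)"
    using homogeneous_mult[OF homogeneous_pvar g(1)] by (intro homogeneous_sum) simp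
  moreover have "w - L * (\<Sum>x\<in>UNIV. pvar x * g x) = (\<Sum>x\<in>UNIV. pvar x * (u x - L * g x))"
    by (simp add: u(2) sum_distrib_left right_diff_distrib sum_subtractf mult.left_commute)
  moreover have "(\<Sum>x\<in>UNIV. pvar x * (u x - L * g x)) \<in> J"
    by (intro ideal_sum[OF J] ideal_mult[OF J] g(2))
  ultimately show ?case by metis
qed

lemma Idl_insert_low_degree:
  assumes S: "homogeneous_ideal (Idl\<^bsub>polyn_ring\<^esub> S)" and f: "homogeneous d f"
    and w: "homogeneous i w" "w \<in> Idl\<^bsub>polyn_ring\<^esub> (insert f S)" and "i < d"
  shows "w \<in> Idl\<^bsub>polyn_ring\<^esub> S"
proof -
  obtain a g where ag: "w = a + f * g" "a \<in> Idl\<^bsub>polyn_ring\<^esub> S"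
    using w(2) by (auto simp: Idl_insert)
  have "w = homogeneous_component i w" using w(1) homogeneous_component_homogeneous[of i w i] by simp
  also have "\<dots> = homogeneous_component i a"
    using \<open>i < d\<close> by (simp add: ag(1) homogeneous_component_add homogeneous_component_mult[OF f])
  finally show ?thesis using ag(2) S by (simp add: homogeneous_ideal_def)
qed

lemma inj_on_graded_piece:
  assumes I: "ideal I polyn_ring"
    and inj: "\<And>g. homogeneous i g \<Longrightarrow> L * g \<in> I \<Longrightarrow> g \<in> I"
  shows "inj_on (\<lambda>a. (I +>\<^bsub>polyn_ring\<^esub> L) \<otimes>\<^bsub>polyn_ring Quot I\<^esub> a) (graded_piece I i)"
proof (rule inj_onI)
  fix a b assume "a \<in> graded_piece I i" "b \<in> graded_piece I i"
    and eq: "(I +>\<^bsub>polyn_ring\<^esub> L) \<otimes>\<^bsub>polyn_ring Quot I\<^esub> a = (I +>\<^bsub>polyn_ring\<^esub> L) \<otimes>\<^bsub>polyn_ring Quot I\<^esub> b"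
  then obtain f g where fg: "homogeneous i f" "homogeneous i g"
    "a = I +>\<^bsub>polyn_ring\<^esub> f" "b = I +>\<^bsub>polyn_ring\<^esub> g"
    unfolding graded_piece_def by blast
  have "L * (f - g) \<in> I"
    using eq by (simp add: fg coset_mult[OF I] coset_eq_iff[OF I] right_diff_distrib)
  then have "f - g \<in> I" by (rule inj[OF homogeneous_diff[OF fg(1,2)]])
  then show "a = b" by (simp add: fg coset_eq_iff[OF I])
qed

lemma image_graded_piece:
  assumes I: "ideal I polyn_ring" and L: "homogeneous 1 L"
    and surj: "\<And>w. homogeneous (Suc i) w \<Longrightarrow> \<exists>g. homogeneous i g \<and> w - L * g \<in> I"
  shows "(\<lambda>a. (I +>\<^bsub>polyn_ring\<^esub> L) \<otimes>\<^bsub>polyn_ring Quot I\<^esub> a) ` graded_piece I i =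
    graded_piece I (Suc i)"
proof -
  have img: "(\<lambda>a. (I +>\<^bsub>polyn_ring\<^esub> L) \<otimes>\<^bsub>polyn_ring Quot I\<^esub> a) ` graded_piece I i =
      (\<lambda>g. I +>\<^bsub>polyn_ring\<^esub> (L * g)) ` {g. homogeneous i g}"
    unfolding graded_piece_def by (simp add: image_image coset_mult[OF I])
  show ?thesis
    unfolding img
  proof
    show "(\<lambda>g. I +>\<^bsub>polyn_ring\<^esub> (L * g)) ` {g. homogeneous i g} \<subseteq> graded_piece I (Suc i)"
      using homogeneous_mult[OF L] by (auto simp: graded_piece_def)
    show "graded_piece I (Suc i) \<subseteq> (\<lambda>g. I +>\<^bsub>polyn_ring\<^esub> (L * g)) ` {g. homogeneous i g}"
    proof
      fix a assume "a \<in> graded_piece I (Suc i)"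
      then obtain w where w: "homogeneous (Suc i) w" "a = I +>\<^bsub>polyn_ring\<^esub> w"
        by (auto simp: graded_piece_def)
      then obtain g where "homogeneous i g" "w - L * g \<in> I" using surj by blast
      then show "a \<in> (\<lambda>g. I +>\<^bsub>polyn_ring\<^esub> (L * g)) ` {g. homogeneous i g}"
        using w(2) coset_eq_iff[OF I, of w "L * g"] by blast
    qed
  qed
qed

section \<open>The weak Lefschetz property\<close>

theorem proposition5p2:
  fixes F :: "nat \<Rightarrow> ('n::finite, 'k::field) polyn"
    and d :: "nat \<Rightarrow> nat"
    and n :: nat
    and I :: "('n, 'k) polyn set"
  assumes infinite_field: "infinite (UNIV :: 'k set)"
    and n: "n = CARD('n)"
    and homogeneous: "\<forall>i\<in>{1..n}. F i \<noteq> 0 \<and> homogeneous (d i) (F i)"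
    and regular: "regular_sequence polyn_ring n F"
    and I: "I = Idl\<^bsub>polyn_ring\<^esub> (F ` {1..n})"
    and d_ge_2: "\<forall>i\<in>{1..n}. 2 \<le> d i"
    and d_mono: "mono_on {1..n} d"
    and degree_condition:
      "(even ((\<Sum>i=1..n. int (d i)) - int n) \<and>
          int (d n) > (\<Sum>i=1..<n. int (d i)) - int n) \<or>
       (odd ((\<Sum>i=1..n. int (d i)) - int n) \<and>
          int (d n) > (\<Sum>i=1..<n. int (d i)) - int n + 1)"
  shows "weak_Lefschetz I"
proof -
  have "n > 0" using n by simp
  then obtain r where r: "n = Suc r" by (cases n) auto
  have before_n: "{1..<n} = {1..r}" using r by auto
  define J where "J = Idl\<^bsub>polyn_ring\<^esub> (F ` {1..r})"
  have J: "ideal J polyn_ring" unfolding J_def by (rule ideal_Idl)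
  have hom: "homogeneous (d i) (F i)" if "i \<in> {1..n}" for i using homogeneous that by blast
  have homJ: "homogeneous_ideal J"
    unfolding J_def using hom r by (intro homogeneous_ideal_Idl[of _ d]) auto
  have IJ: "I = Idl\<^bsub>polyn_ring\<^esub> (insert (F n) (F ` {1..r}))"
    unfolding I by (simp add: r atLeastAtMostSuc_conv)
  have idI: "ideal I polyn_ring" unfolding I by (rule ideal_Idl)
  have "J \<subseteq> I"
    unfolding IJ J_def Idl_insert by (force intro: exI[of _ 0])
  have nzd: "g \<in> Idl\<^bsub>polyn_ring\<^esub> (F ` {1..<i})"
    if "i \<in> {1..n}" "F i * g \<in> Idl\<^bsub>polyn_ring\<^esub> (F ` {1..<i})" for i g
    using regular that by (auto simp: regular_sequence_def Let_def nonzerodivisor_Quot_iff[OF ideal_Idl])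
  (* below degree d n the quotients by I and by J agree, and m is the last such degree *)
  define m where "m = d n - 1"
  have "2 \<le> d n" using d_ge_2 \<open>n > 0\<close> by simp
  then have dn: "d n = Suc m" by (simp add: m_def)
  (* in case (a) parity rules out equality in the next smaller bound, since the total of all degrees
     minus n would then be 2 * d n - 1 *)
  have "int (d n) \<ge> (\<Sum>i=1..r. int (d i)) - int n + 2"
  proof -
    have "(\<Sum>i=1..n. int (d i)) = (\<Sum>i=1..r. int (d i)) + int (d n)" by (simp add: r)
    then show ?thesis using degree_condition unfolding before_n by presburger
  qed
  moreover have "int (\<Sum>i=1..r. d i - 1) = (\<Sum>i=1..r. int (d i)) - int r"
  proof -
    have "int (\<Sum>i=1..r. d i - 1) = (\<Sum>i=1..r. int (d i) - 1)"
      unfolding of_nat_sum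
    proof (rule sum.cong[OF refl])
      fix x assume "x \<in> {1..r}"
      then have "2 \<le> d x" using d_ge_2 r by simp
      then show "int (d x - 1) = int (d x) - 1" by simp
    qed
    then show ?thesis by (simp add: sum_subtractf)
  qed
  ultimately have socle: "(\<Sum>i=1..r. d i - 1) \<le> m" using dn r by linarith
  have sat: "a \<in> J" if "\<And>x. pvar x * a \<in> J" for a
  proof (rule ideal_saturated_if_nonzerodivisor[OF J hom[of n] _ _ that])
    show "n \<in> {1..n}" "0 < d n" using \<open>n > 0\<close> dn by auto
    show "g \<in> J" if "F n * g \<in> J" for g
      using nzd[of n g] that \<open>n > 0\<close> unfolding J_def before_n by simp
  qed
  have dims: "hilbert_function J (Suc m) = hilbert_function J m"
    unfolding J_def
  proof (rule hilbert_function_eventually_constant[OF _ _ _ socle])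
    show "Suc r = CARD('n)" using n r by simp
  qed (use hom nzd r in auto)
  obtain U where U: "zariski_open U" "U \<noteq> {}"
    and inj: "\<And>c g. c \<in> U \<Longrightarrow> homogeneous m g \<Longrightarrow> linear_form c * g \<in> J \<Longrightarrow> g \<in> J"
    using general_linear_form_injective[OF infinite_field J sat dims] by metis
  have "inj_on (\<lambda>a. (I +>\<^bsub>polyn_ring\<^esub> linear_form c) \<otimes>\<^bsub>polyn_ring Quot I\<^esub> a) (graded_piece I i) \<or>
      (\<lambda>a. (I +>\<^bsub>polyn_ring\<^esub> linear_form c) \<otimes>\<^bsub>polyn_ring Quot I\<^esub> a) ` graded_piece I i =
        graded_piece I (Suc i)" if c: "c \<in> U" for c i
  proof (cases "i < m")
    case True
    have "g \<in> I" if g: "homogeneous i g" "linear_form c * g \<in> I" for g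
    proof -
      have "homogeneous (Suc i) (linear_form c * g)"
        using homogeneous_mult[OF homogeneous_linear_form g(1), of c] by simp
      then have "linear_form c * g \<in> J"
        using Idl_insert_low_degree[of "F ` {1..r}" "d n" "F n" "Suc i"] homJ hom[of n] g(2)
          True dn \<open>n > 0\<close> unfolding J_def IJ by simp
      then have "g \<in> J"
        using multiplication_injective_below[OF sat J inj[OF c], where i = i and g = g]
          True g(1) by simp
      then show ?thesis using \<open>J \<subseteq> I\<close> by blast
    qed
    then show ?thesis using inj_on_graded_piece[OF idI] by blast
  next
    case False
    have surj_m: "\<exists>g. homogeneous m g \<and> w - linear_form c * g \<in> J" if "homogeneous (Suc m) w" for w
      using multiplication_surjective_if_injective[OF J homogeneous_linear_form inj[OF c] dims that]
      by blast
    have "\<exists>g. homogeneous i g \<and> w - linear_form c * g \<in> I" if "homogeneous (Suc i) w" for w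
      using multiplication_surjective_above[OF J surj_m, where i = i and w = w] that False \<open>J \<subseteq> I\<close> by auto
    then show ?thesis using image_graded_piece[OF idI homogeneous_linear_form] by blast
  qed
  then show ?thesis
    unfolding weak_Lefschetz_def for_general_linear_form_def Let_def using U by blast
qed

end
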